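(* Let $\Omega\subset\mathbb{R}^2$, $\theta$, $F$, $G$, $u_0$ satisfy the standing assumptions (including A1--A4) listed in the context. Then there exists a positive constant $C_1$, independent of time (i.e. independent of $T>0$), such that every smooth solution $u$ of $$ \begin{cases} u_t = G(Du,-1)\, D^2_{p_ip_j}F(Du,-1)\,u_{x_ix_j} & \text{in } Q_T=\Omega\times[0,T],\\ D_N u = -\sqrt{1+|Du|^2}\,\cos\theta & \text{on } \Gamma_T=\partial\Omega\times[0,T],\\ u(\cdot,0)=u_0(\cdot) & \text{in } \Omega_0=\Omega\times\{0\}, \end{cases} $$ satisfies $$\sup_{Q_T}|Du|\le C_1 .$$
   Context: Here $n=2$. $Du$ is the spatial gradient of $u$; repeated indices $i,j$ are summed over $1\le i,j\le n$, and $D^2_{p_ip_j}F$ denotes second derivatives of $F$ with respect to its first $n$ variables. $N$ is the unit inward normal, $T$ (as a vector) the unit tangent, and $k$ the curvature of $\partial\Omega$ (positive for convex domains). Anisotropy and mobility: $F$ and $G$ are positive functions on the unit sphere $\mathbb{S}^n\subset\mathbb{R}^{n+1}$ extended to $\mathbb{R}^{n+1}$ by homogeneity of degree one ($F(\lambda p)=\lambda F(p)$, $G(\lambda p)=\lambda G(p)$ for $\lambda>0$), smooth away from the origin; $F$ is convex on $\mathbb{R}^{n+1}$. With $\xi=\xi(p)=p/|p|$, $F(\xi)$ is regarded as the degree-zero homogeneous function $p\mapsto F(p/|p|)$, and $D_{p_i}F(\xi)$, $D^2_{p_ip_j}F(\xi)$ are its derivatives in $p$. There are positive constants $g_0,G_0,m_0,M_0,m_1,m_2$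 such that for all $p\neq 0$ and $1\le i,j\le n$: $g_0\le G(\xi)\le G_0$; $m_0\le F(\xi)\le M_0$; $|D_{p_i}F(\xi)|<m_1/|p|$; $\|[D^2_{p_ip_j}F(\xi)]_{1\le i,j\le n}\|<m_2/|p|^2$, where $\|M\|=\sqrt{\mathrm{tr}(M^TM)}$ is the Frobenius norm. A1. $\Omega\subset\mathbb{R}^2$ is a bounded domain of class $C^3$, uniformly convex: there are positive constants $k_0,k_1$ with $k_0\le k(x)\le k_1$ for all $x\in\partial\Omega$. A2. $\theta$ is a (smooth) function on $\partial\Omega$ and there are positive constants $\delta_0,\theta_0$ such that $|D_T\theta(x)|\le k(x)-\delta_0$ for all $x\in\partial\Omega$ and $\theta_0\le\theta\le\pi-\theta_0$. A3. $m_2<m_0$. A4. $u_0\in C^3(\overline\Omega)$ and $D_Nu_0=-\sqrt{1+|Du_0|^2}\cos\theta$ on $\partial\Omega$. *)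

theory Defs
  imports "HOL-Analysis.Analysis"
begin

section \<open>Derivatives and classes of functions\<close>

text \<open>
  All derivatives are taken relative to a set \<open>S\<close>. Below, \<open>S\<close> is an open set, the closure of a domain
  with \<open>C^3\<close> boundary, or a compact interval of positive length; on such sets the relative derivative
  of a differentiable function is unique. On the closure of a domain it gives the one-sided
  derivatives up to the boundary.
\<close>

definition pd :: "'a::real_normed_vector set \<Rightarrow> 'a \<Rightarrow> ('a \<Rightarrow> real) \<Rightarrow> 'a \<Rightarrow> real" where
  "pd S v f x = frechet_derivative f (at x within S) v"

definition grad :: "'a::euclidean_space set \<Rightarrow> ('a \<Rightarrow> real) \<Rightarrow> 'a \<Rightarrow> 'a" where
  "grad S f x = (\<Sum>b\<in>Basis. pd S b f x *\<^sub>R b)"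

text \<open>For the closure of a domain with \<open>C^1\<close> boundary this is the usual class of functions all of whose
  derivatives of order at most \<open>k\<close> extend continuously to the closure.\<close>

fun C_on :: "nat \<Rightarrow> 'a::euclidean_space set \<Rightarrow> ('a \<Rightarrow> real) \<Rightarrow> bool" where
  "C_on 0 S f \<longleftrightarrow> continuous_on S f"
| "C_on (Suc k) S f \<longleftrightarrow> f differentiable_on S \<and> (\<forall>b\<in>Basis. C_on k S (pd S b f))"

definition smooth_on :: "'a::euclidean_space set \<Rightarrow> ('a \<Rightarrow> real) \<Rightarrow> bool" where
  "smooth_on S f \<longleftrightarrow> (\<forall>k. C_on k S f)"

section \<open>Geometry of the domain\<close>

definition local_defining_function ::
    "nat \<Rightarrow> (real^2) set \<Rightarrow> real^2 \<Rightarrow> (real^2) set \<Rightarrow> (real^2 \<Rightarrow> real) \<Rightarrow> bool" where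
  "local_defining_function k \<Omega> x U \<rho> \<longleftrightarrow>
     open U \<and> x \<in> U \<and> C_on k U \<rho> \<and> (\<forall>y\<in>U. grad U \<rho> y \<noteq> 0) \<and> \<Omega> \<inter> U = {y\<in>U. \<rho> y > 0}"

definition bounded_domain_of_class :: "nat \<Rightarrow> (real^2) set \<Rightarrow> bool" where
  "bounded_domain_of_class k \<Omega> \<longleftrightarrow>
     open \<Omega> \<and> connected \<Omega> \<and> \<Omega> \<noteq> {} \<and> bounded \<Omega> \<and>
     (\<forall>x\<in>frontier \<Omega>. \<exists>U \<rho>. local_defining_function k \<Omega> x U \<rho>)"

text \<open>\<open>\<Omega>\<close> lies on the side \<open>\<rho> > 0\<close>, so the normalised gradient of \<open>\<rho>\<close> points into \<open>\<Omega>\<close>; it does not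
  depend on the choice of \<open>\<rho>\<close>.\<close>

definition inward_normal :: "(real^2) set \<Rightarrow> real^2 \<Rightarrow> real^2" where
  "inward_normal \<Omega> x =
     (THE \<nu>. \<exists>U \<rho>. local_defining_function 3 \<Omega> x U \<rho> \<and> \<nu> = sgn (grad U \<rho> x))"

definition unit_tangent :: "(real^2) set \<Rightarrow> real^2 \<Rightarrow> real^2" where
  "unit_tangent \<Omega> x = vector [inward_normal \<Omega> x $ 2, - inward_normal \<Omega> x $ 1]"

text \<open>For a function \<open>f\<close> given only on \<open>\<partial>\<Omega>\<close>, the derivative relative to \<open>\<partial>\<Omega>\<close> is determined only in
  tangential directions. It is therefore evaluated only at the unit tangent.\<close>

definition tangential_deriv ::
    "(real^2) set \<Rightarrow> (real^2 \<Rightarrow> 'b::real_normed_vector) \<Rightarrow> real^2 \<Rightarrow> 'b" where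
  "tangential_deriv \<Omega> f x = frechet_derivative f (at x within frontier \<Omega>) (unit_tangent \<Omega> x)"

text \<open>Frenet's formula \<open>D\<^sub>T N = - k T\<close>. With \<open>N\<close> the inward normal, \<open>k = 1 / r\<close> for a disc of radius
  \<open>r\<close>.\<close>

definition curvature :: "(real^2) set \<Rightarrow> real^2 \<Rightarrow> real" where
  "curvature \<Omega> x = - (tangential_deriv \<Omega> (inward_normal \<Omega>) x \<bullet> unit_tangent \<Omega> x)"

definition C_on_boundary :: "nat \<Rightarrow> (real^2) set \<Rightarrow> (real^2 \<Rightarrow> real) \<Rightarrow> bool" where
  "C_on_boundary k \<Omega> f \<longleftrightarrow>
     (\<exists>U g. open U \<and> frontier \<Omega> \<subseteq> U \<and> C_on k U g \<and> (\<forall>x\<in>frontier \<Omega>. g x = f x))"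

section \<open>Anisotropy and mobility\<close>

definition positive_homogeneous_smooth :: "(real^3 \<Rightarrow> real) \<Rightarrow> bool" where
  "positive_homogeneous_smooth F \<longleftrightarrow>
     (\<forall>p. p \<noteq> 0 \<longrightarrow> F p > 0) \<and> (\<forall>c>0. \<forall>p. F (c *\<^sub>R p) = c * F p) \<and> smooth_on (- {0}) F"

text \<open>The degree-zero function \<open>F(\<xi>)\<close>, \<open>\<xi> = p / |p|\<close>.\<close>

definition F_xi :: "(real^3 \<Rightarrow> real) \<Rightarrow> real^3 \<Rightarrow> real" where
  "F_xi F p = F (p /\<^sub>R norm p)"

definition e3 :: "2 \<Rightarrow> real^3" where
  "e3 i = (if i = 1 then axis 1 1 else axis 2 1)"

text \<open>Derivatives in \<open>p\<close> with respect to the first two of the three variables only.\<close>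

definition Dp :: "2 \<Rightarrow> (real^3 \<Rightarrow> real) \<Rightarrow> real^3 \<Rightarrow> real" where
  "Dp i F p = pd UNIV (e3 i) F p"

definition D2p :: "(real^3 \<Rightarrow> real) \<Rightarrow> real^3 \<Rightarrow> real^2^2" where
  "D2p F p = (\<chi> i j. Dp j (Dp i F) p)"

definition frobenius_norm :: "real^2^2 \<Rightarrow> real" where
  "frobenius_norm M = sqrt (trace (transpose M ** M))"

definition structure_bounds ::
    "(real^3 \<Rightarrow> real) \<Rightarrow> (real^3 \<Rightarrow> real) \<Rightarrow> real \<Rightarrow> real \<Rightarrow> real \<Rightarrow> real \<Rightarrow> real \<Rightarrow> real \<Rightarrow> bool" where
  "structure_bounds F G g0 G0 m0 M0 m1 m2 \<longleftrightarrow>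
     0 < g0 \<and> 0 < G0 \<and> 0 < m0 \<and> 0 < M0 \<and> 0 < m1 \<and> 0 < m2 \<and>
     (\<forall>p. p \<noteq> 0 \<longrightarrow>
        g0 \<le> F_xi G p \<and> F_xi G p \<le> G0 \<and>
        m0 \<le> F_xi F p \<and> F_xi F p \<le> M0 \<and>
        (\<forall>i. \<bar>Dp i (F_xi F) p\<bar> < m1 / norm p) \<and>
        frobenius_norm (D2p (F_xi F) p) < m2 / (norm p)\<^sup>2)"

section \<open>The initial boundary value problem\<close>

definition contact_angle_condition ::
    "(real^2) set \<Rightarrow> (real^2 \<Rightarrow> real) \<Rightarrow> (real^2 \<Rightarrow> real) \<Rightarrow> bool" where
  "contact_angle_condition \<Omega> \<theta> w \<longleftrightarrow>
     (\<forall>x\<in>frontier \<Omega>.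
        grad (closure \<Omega>) w x \<bullet> inward_normal \<Omega> x =
        - sqrt (1 + (norm (grad (closure \<Omega>) w x))\<^sup>2) * cos (\<theta> x))"

abbreviation Dx :: "(real^2) set \<Rightarrow> (real^2 \<Rightarrow> real \<Rightarrow> real) \<Rightarrow> real^2 \<Rightarrow> real \<Rightarrow> real^2" where
  "Dx \<Omega> u x t \<equiv> grad (closure \<Omega>) (\<lambda>y. u y t) x"

abbreviation Dxx :: "(real^2) set \<Rightarrow> (real^2 \<Rightarrow> real \<Rightarrow> real) \<Rightarrow> 2 \<Rightarrow> 2 \<Rightarrow> real^2 \<Rightarrow> real \<Rightarrow> real" where
  "Dxx \<Omega> u i j x t \<equiv>
     pd (closure \<Omega>) (axis j 1) (pd (closure \<Omega>) (axis i 1) (\<lambda>y. u y t)) x"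

abbreviation Dt :: "real \<Rightarrow> (real^2 \<Rightarrow> real \<Rightarrow> real) \<Rightarrow> real^2 \<Rightarrow> real \<Rightarrow> real" where
  "Dt T u x t \<equiv> pd {0..T} 1 (u x) t"

text \<open>Since \<open>\<partial>\<Omega>\<close> and the initial datum are only of class \<open>C^3\<close>, solutions are in general not \<open>C^\<infinity>\<close> up to
  the parabolic boundary. A smooth solution is \<open>C^\<infinity>\<close> inside, and the derivatives occurring in the
  equation exist and are continuous up to the boundary, including times \<open>0\<close> and \<open>T\<close>. Functions that
  are \<open>C^\<infinity>\<close> up to the boundary are included.\<close>

definition smooth_up_to_boundary ::
    "(real^2) set \<Rightarrow> real \<Rightarrow> (real^2 \<Rightarrow> real \<Rightarrow> real) \<Rightarrow> bool" where
  "smooth_up_to_boundary \<Omega> T u \<longleftrightarrow>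
     smooth_on (\<Omega> \<times> {0<..<T}) (\<lambda>(x, t). u x t) \<and>
     (\<forall>t\<in>{0..T}. C_on 2 (closure \<Omega>) (\<lambda>x. u x t)) \<and>
     (\<forall>x\<in>closure \<Omega>. u x differentiable_on {0..T}) \<and>
     continuous_on (closure \<Omega> \<times> {0..T}) (\<lambda>(x, t). u x t) \<and>
     continuous_on (closure \<Omega> \<times> {0..T}) (\<lambda>(x, t). Dx \<Omega> u x t) \<and>
     (\<forall>i j. continuous_on (closure \<Omega> \<times> {0..T}) (\<lambda>(x, t). Dxx \<Omega> u i j x t)) \<and>
     continuous_on (closure \<Omega> \<times> {0..T}) (\<lambda>(x, t). Dt T u x t)"

text \<open>The vector \<open>(q, -1)\<close>.\<close>

definition graph_normal :: "real^2 \<Rightarrow> real^3" where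
  "graph_normal q = vector [q $ 1, q $ 2, -1]"

definition smooth_solution ::
    "(real^2) set \<Rightarrow> (real^3 \<Rightarrow> real) \<Rightarrow> (real^3 \<Rightarrow> real) \<Rightarrow> (real^2 \<Rightarrow> real) \<Rightarrow> (real^2 \<Rightarrow> real) \<Rightarrow>
     real \<Rightarrow> (real^2 \<Rightarrow> real \<Rightarrow> real) \<Rightarrow> bool" where
  "smooth_solution \<Omega> F G \<theta> u\<^sub>0 T u \<longleftrightarrow>
     smooth_up_to_boundary \<Omega> T u \<and>
     (\<forall>x\<in>\<Omega>. \<forall>t\<in>{0..T}.
        Dt T u x t =
        (\<Sum>i\<in>UNIV. \<Sum>j\<in>UNIV.
           G (graph_normal (Dx \<Omega> u x t)) * D2p F (graph_normal (Dx \<Omega> u x t)) $ i $ j *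
           Dxx \<Omega> u i j x t)) \<and>
     (\<forall>t\<in>{0..T}. contact_angle_condition \<Omega> \<theta> (\<lambda>x. u x t)) \<and>
     (\<forall>x\<in>\<Omega>. u x 0 = u\<^sub>0 x)"

end

theory Submission
  imports Defs
begin

text \<open>
  The estimate is obtained from maximum principles. Write \<open>A(q) = G(q,-1) D\<^sup>2\<^sub>pF(q,-1)\<close> for the
  coefficients of the equation; convexity of \<open>F\<close> makes \<open>A(q)\<close> positive semidefinite, and \<open>m2 < m0\<close>
  makes it quantitatively positive in the direction orthogonal to \<open>q\<close>
  (\<open>flow_matrix_orthogonal\<close>).

  \<^item> Comparison (\<open>comparison_principle\<close>). At a lateral maximum of the difference of two evolutions with
  the same contact angle the tangential derivatives agree. The contact angle condition determines the
  normal derivative from the tangential one and forces the one-sided inequality between the normal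
  derivatives to be an equality. So the gradients agree, and then the second order Taylor expansion
  along the inward directions, which fill a half-plane, gives the full Hessian inequality, exactly as
  at an interior maximum.

  \<^item> Time derivative (\<open>time_derivative_bound\<close>). Comparing \<open>u\<close> with \<open>u\<^sub>0 \<plusminus> K t\<close> and then with its own
  translates in time gives \<open>\<bar>u\<^sub>t\<bar> \<le> K\<close>, where \<open>K\<close> bounds the elliptic operator on \<open>u\<^sub>0\<close>.

  \<^item> Interior gradient (\<open>gradient_max_principle\<close>). The equation does not contain \<open>x\<close>, so \<open>u\<close> can be
  compared with its translates in space. This shows that \<open>\<bar>Du\<bar>\<close> is largest on the parabolic boundary.

  \<^item> Boundary gradient (\<open>boundary_gradient_bound\<close>). Let \<open>\<bar>Du\<bar>\<close> have its maximum over the closed domain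
  at a boundary point, let \<open>p = Du\<close>, \<open>H = D\<^sup>2u\<close>, and let \<open>N\<close>, \<open>T\<close> be the normal and the tangent.
  Then \<open>p \<bullet> H T = 0\<close> and \<open>p \<bullet> H N \<le> 0\<close>, and the tangential derivative of the contact angle condition
  is \<open>H\<^sub>N\<^sub>T = k p\<^sub>T + sqrt (1 + \<bar>p\<bar>\<^sup>2) sin \<theta> D\<^sub>T\<theta>\<close>. By the hypothesis on \<open>D\<^sub>T\<theta>\<close> this equals \<open>\<beta> p\<^sub>T\<close> with
  \<open>\<beta> \<ge> \<delta>0 / 2\<close> as soon as \<open>p\<^sub>T\<close> is large. Eliminating \<open>H\<^sub>N\<^sub>N\<close> and \<open>H\<^sub>T\<^sub>T\<close> one finds, with
  \<open>\<nu> = p\<^sub>T N - p\<^sub>N T\<close>,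

    \<open>p\<^sub>N u\<^sub>t = A\<^sub>N\<^sub>N (p \<bullet> H N) - \<beta> (\<nu> \<bullet> A \<nu>) \<le> - (\<delta>0 / 2) g0 (m0 - m2) \<bar>p\<bar>\<^sup>2\<close>,

  because \<open>\<nu>\<close> is orthogonal to \<open>p\<close> and as long as \<open>p\<close>. The left side is at least \<open>- K \<bar>p\<bar>\<close>, which bounds
  \<open>\<bar>p\<bar>\<close>. If \<open>p\<^sub>T\<close> is not large, the contact angle, which stays away from \<open>0\<close> and \<open>\<pi>\<close>, bounds \<open>\<bar>p\<bar>\<close>.
\<close>

section \<open>Gradient and Hessian relative to a set\<close>

definition hess :: "(real^2) set \<Rightarrow> (real^2 \<Rightarrow> real) \<Rightarrow> real^2 \<Rightarrow> real^2^2" where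
  "hess S f x = (\<chi> i j. pd S (axis j 1) (pd S (axis i 1) f) x)"

lemma C_on_Suc_imp: "C_on (Suc k) S f \<Longrightarrow> C_on k S f"
proof (induction k arbitrary: f)
  case 0
  then show ?case by (simp add: differentiable_imp_continuous_on)
next
  case (Suc k)
  then show ?case by (metis C_on.simps(2))
qed

lemma axis_in_Basis_real: "axis i (1::real) \<in> (Basis :: (real^'n) set)"
  by (auto simp: Basis_vec_def)

lemma has_derivative_grad:
  fixes f :: "'a::euclidean_space \<Rightarrow> real"
  assumes "f differentiable (at x within S)"
  shows "(f has_derivative (\<lambda>h. grad S f x \<bullet> h)) (at x within S)"
proof -
  have D: "(f has_derivative frechet_derivative f (at x within S)) (at x within S)"
    using assms frechet_derivative_works by blast
  interpret L: bounded_linear "frechet_derivative f (at x within S)"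
    using D has_derivative_bounded_linear by blast
  have "frechet_derivative f (at x within S) h = grad S f x \<bullet> h" for h
  proof -
    have "frechet_derivative f (at x within S) h
        = frechet_derivative f (at x within S) (\<Sum>b\<in>Basis. (h \<bullet> b) *\<^sub>R b)"
      by (simp add: euclidean_representation)
    also have "\<dots> = (\<Sum>b\<in>Basis. (h \<bullet> b) * pd S b f x)"
      by (simp add: L.sum L.scale pd_def)
    also have "\<dots> = grad S f x \<bullet> h"
      
      unfolding grad_def inner_sum_left by (intro sum.cong) (simp_all add: inner_commute)
    finally show ?thesis .
  qed
  then show ?thesis using D by presburger
qed

lemma grad_component:
  fixes f :: "real^2 \<Rightarrow> real"
  shows "grad S f x $ i = pd S (axis i 1) f x"
proof -
  have "grad S f x \<bullet> axis i 1 = pd S (axis i 1) f x"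
    unfolding grad_def
    by (simp add: inner_sum_left inner_Basis axis_in_Basis_real if_distrib sum.delta cong: if_cong)
  then show ?thesis by (simp add: inner_axis)
qed

lemma C_on_2_derivatives:
  fixes f :: "real^2 \<Rightarrow> real"
  assumes "C_on 2 S f"
  shows C_on_2_grad: "x \<in> S \<Longrightarrow> (f has_derivative (\<lambda>h. grad S f x \<bullet> h)) (at x within S)"
    and C_on_2_hess: "x \<in> S \<Longrightarrow> (grad S f has_derivative (\<lambda>h. hess S f x *v h)) (at x within S)"
    and C_on_2_cont_hess: "continuous_on S (hess S f)"
    and C_on_2_cont_grad: "continuous_on S (grad S f)"
    and C_on_2_cont: "continuous_on S f"
proof -
  have d: "f differentiable_on S" "\<And>b. b \<in> Basis \<Longrightarrow> pd S b f differentiable_on S"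
    "\<And>b c. b \<in> Basis \<Longrightarrow> c \<in> Basis \<Longrightarrow> continuous_on S (pd S c (pd S b f))"
    using assms by (auto simp: numeral_2_eq_2)
  show "x \<in> S \<Longrightarrow> (f has_derivative (\<lambda>h. grad S f x \<bullet> h)) (at x within S)"
    using d(1) has_derivative_grad by (auto simp: differentiable_on_def)
  show H: "(grad S f has_derivative (\<lambda>h. hess S f x *v h)) (at x within S)" if "x \<in> S" for x
  proof (subst has_derivative_componentwise_within, rule ballI)
    fix b :: "real^2" assume "b \<in> Basis"
    then obtain i where b: "b = axis i 1" by (auto simp: Basis_vec_def)
    have "(pd S b f has_derivative (\<lambda>h. grad S (pd S b f) x \<bullet> h)) (at x within S)"
      using d(2)[OF \<open>b \<in> Basis\<close>] has_derivative_grad that by (auto simp: differentiable_on_def)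
    moreover have "(\<lambda>h. grad S (pd S b f) x \<bullet> h) = (\<lambda>h. (hess S f x *v h) \<bullet> b)"
      by (simp add: b inner_vec_def hess_def matrix_vector_mult_def grad_component axis_def fun_eq_iff
          if_distrib sum.delta cong: if_cong)
    ultimately show "((\<lambda>x. grad S f x \<bullet> b) has_derivative (\<lambda>h. (hess S f x *v h) \<bullet> b)) (at x within S)"
      by (simp add: b inner_axis grad_component)
  qed
  show "continuous_on S (hess S f)"
    unfolding hess_def
    by (intro continuous_on_vec_lambda d(3)) (auto simp: axis_in_Basis_real)
  show "continuous_on S (grad S f)"
    by (rule has_derivative_continuous_on[OF H])
  show "continuous_on S f"
    using d(1) differentiable_imp_continuous_on by blast
qed

text \<open>The mean value theorem in the direction \<open>a\<close> turns the second difference into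
  \<open>s (p (y + s b) - p y) \<bullet> a\<close> at an intermediate point \<open>y\<close>. Differentiability of the gradient \<open>p\<close> at
  the single point \<open>x\<close> is then enough for the limit.\<close>

lemma second_difference_quotient:
  fixes f :: "'a::euclidean_space \<Rightarrow> real"
  assumes r: "0 < r" and f: "\<And>y. y \<in> ball x r \<Longrightarrow> (f has_derivative (\<lambda>h. p y \<bullet> h)) (at y)"
    and p: "(p has_derivative H) (at x)"
  shows "((\<lambda>s. (f (x + s *\<^sub>R a + s *\<^sub>R b) - f (x + s *\<^sub>R a) - f (x + s *\<^sub>R b) + f x) / s\<^sup>2)
          \<longlongrightarrow> H b \<bullet> a) (at_right 0)"
proof (rule tendstoI)
  fix e :: real assume "0 < e"
  interpret H: bounded_linear H using p has_derivative_bounded_linear by blast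
  define C where "C = norm a * (2 * norm a + norm b) + 1"
  have C: "C > 0" unfolding C_def by (simp add: add_nonneg_pos)
  obtain d where d: "0 < d" "\<And>z. norm (z - x) < d \<Longrightarrow> norm (p z - p x - H (z - x)) \<le> e / C * norm (z - x)"
    using p[unfolded has_derivative_at_alt] \<open>0 < e\<close> C by (meson divide_pos_pos)
  define m where "m = min d r / (norm a + norm b + 1)"
  have q: "norm a + norm b + 1 > 0" by (simp add: add_nonneg_pos)
  then have m: "0 < m" using d(1) r by (simp add: m_def)
  have "dist ((f (x + s *\<^sub>R a + s *\<^sub>R b) - f (x + s *\<^sub>R a) - f (x + s *\<^sub>R b) + f x) / s\<^sup>2) (H b \<bullet> a) < e"
    if s: "0 < s" "s < m" for s
  proof -
    have sm: "s * (norm a + norm b + 1) < min d r"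
      using s(2) q by (simp add: m_def pos_less_divide_eq)
    have near: "norm (u *\<^sub>R a + w *\<^sub>R b) \<le> s * (norm a + norm b) \<and> norm (u *\<^sub>R a + w *\<^sub>R b) < min d r"
      if "0 \<le> u" "u \<le> s" "0 \<le> w" "w \<le> s" for u w
    proof -
      have "norm (u *\<^sub>R a + w *\<^sub>R b) \<le> u * norm a + w * norm b"
        using norm_triangle_ineq[of "u *\<^sub>R a" "w *\<^sub>R b"] that by simp
      also have "\<dots> \<le> s * norm a + s * norm b"
        using that by (intro add_mono mult_right_mono) auto
      finally show ?thesis using sm s(1) by (simp add: algebra_simps)
    qed
    define g where "g = (\<lambda>u. f (x + u *\<^sub>R a + s *\<^sub>R b) - f (x + u *\<^sub>R a))"
    have der: "(g has_real_derivative (p (x + u *\<^sub>R a + s *\<^sub>R b) - p (x + u *\<^sub>R a)) \<bullet> a) (at u)"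
      if u: "0 \<le> u" "u \<le> s" for u
    proof -
      have 1: "x + u *\<^sub>R a + s *\<^sub>R b \<in> ball x r" "x + u *\<^sub>R a \<in> ball x r"
        using near[of u s] near[of u 0] u s by (auto simp: dist_norm norm_minus_commute algebra_simps)
      have l: "((\<lambda>u. x + u *\<^sub>R a + c) has_derivative (\<lambda>h. h *\<^sub>R a)) (at u)" for c
        by (auto intro!: derivative_eq_intros)
      have "((\<lambda>u. f (x + u *\<^sub>R a + s *\<^sub>R b)) has_derivative (\<lambda>h. p (x + u *\<^sub>R a + s *\<^sub>R b) \<bullet> (h *\<^sub>R a))) (at u)"
        using has_derivative_compose[OF l f[OF 1(1)]] .
      moreover have "((\<lambda>u. f (x + u *\<^sub>R a)) has_derivative (\<lambda>h. p (x + u *\<^sub>R a) \<bullet> (h *\<^sub>R a))) (at u)"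
        using has_derivative_compose[OF l[of 0], of f "\<lambda>h. p (x + u *\<^sub>R a) \<bullet> h"] f[OF 1(2)] by simp
      ultimately have "(g has_derivative (\<lambda>h. p (x + u *\<^sub>R a + s *\<^sub>R b) \<bullet> (h *\<^sub>R a) - p (x + u *\<^sub>R a) \<bullet> (h *\<^sub>R a))) (at u)"
        unfolding g_def by (rule has_derivative_diff)
      then show ?thesis
        unfolding has_field_derivative_def
        by (rule has_derivative_eq_rhs) (auto simp: inner_diff_left algebra_simps)
    qed
    obtain u where u: "0 < u" "u < s"
      "g s - g 0 = (s - 0) * ((p (x + u *\<^sub>R a + s *\<^sub>R b) - p (x + u *\<^sub>R a)) \<bullet> a)"
      using MVT2[OF s(1) der] by blast
    define D where "D = p (x + u *\<^sub>R a + s *\<^sub>R b) - p (x + u *\<^sub>R a) - s *\<^sub>R H b"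
    have "D = (p (x + u *\<^sub>R a + s *\<^sub>R b) - p x - H (u *\<^sub>R a + s *\<^sub>R b)) - (p (x + u *\<^sub>R a) - p x - H (u *\<^sub>R a))"
      by (simp add: D_def H.add H.scale)
    also have "norm \<dots> \<le> e / C * norm (u *\<^sub>R a + s *\<^sub>R b) + e / C * norm (u *\<^sub>R a)"
      using d(2)[of "x + u *\<^sub>R a + s *\<^sub>R b"] d(2)[of "x + u *\<^sub>R a"] near[of u s] near[of u 0] u s
      by (intro order_trans[OF norm_triangle_ineq4]) (auto simp: add.assoc)
    also have "\<dots> \<le> e / C * (s * (norm a + norm b)) + e / C * (s * norm a)"
      using near[of u s] u s \<open>0 < e\<close> C by (intro add_mono mult_left_mono) (auto intro: mult_right_mono)
    also have "\<dots> = e / C * s * (2 * norm a + norm b)" by (simp add: algebra_simps)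
    finally have D: "norm D \<le> e / C * s * (2 * norm a + norm b)" .
    have "(f (x + s *\<^sub>R a + s *\<^sub>R b) - f (x + s *\<^sub>R a) - f (x + s *\<^sub>R b) + f x) / s\<^sup>2 = (g s - g 0) / s\<^sup>2"
      by (simp add: g_def)
    also have "\<dots> = H b \<bullet> a + (D \<bullet> a) / s"
      using s unfolding u(3) D_def by (simp add: field_simps power2_eq_square inner_diff_left inner_add_left)
    finally have "dist ((f (x + s *\<^sub>R a + s *\<^sub>R b) - f (x + s *\<^sub>R a) - f (x + s *\<^sub>R b) + f x) / s\<^sup>2) (H b \<bullet> a)
        = \<bar>D \<bullet> a\<bar> / s" using s by (simp add: dist_real_def)
    also have "\<dots> \<le> norm D * norm a / s"
      using s by (intro divide_right_mono) (auto simp: Cauchy_Schwarz_ineq2)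
    also have "\<dots> \<le> (e / C * s * (2 * norm a + norm b)) * norm a / s"
      using s D by (intro divide_right_mono mult_right_mono) auto
    also have "\<dots> = e * (norm a * (2 * norm a + norm b) / C)" using s by (simp add: mult.commute)
    also have "\<dots> = e * ((C - 1) / C)" by (simp add: C_def)
    also have "\<dots> < e" using C \<open>0 < e\<close> by (simp add: field_simps)
    finally show ?thesis .
  qed
  then show "\<forall>\<^sub>F s in at_right 0. dist ((f (x + s *\<^sub>R a + s *\<^sub>R b) - f (x + s *\<^sub>R a) - f (x + s *\<^sub>R b) + f x) / s\<^sup>2) (H b \<bullet> a) < e"
    using m unfolding eventually_at_right_field by (intro exI[of _ m]) auto
qed

text \<open>The second difference does not change when \<open>a\<close> and \<open>b\<close> are exchanged.\<close>

lemma second_derivative_symmetric: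
  fixes f :: "'a::euclidean_space \<Rightarrow> real"
  assumes "open U" "x \<in> U" "\<And>y. y \<in> U \<Longrightarrow> (f has_derivative (\<lambda>h. p y \<bullet> h)) (at y)"
    and p: "(p has_derivative H) (at x)"
  shows "H a \<bullet> b = H b \<bullet> a"
proof -
  obtain r where r: "0 < r" "ball x r \<subseteq> U" using assms(1,2) open_contains_ball by blast
  have f: "\<And>y. y \<in> ball x r \<Longrightarrow> (f has_derivative (\<lambda>h. p y \<bullet> h)) (at y)" using r(2) assms(3) by blast
  have e: "(\<lambda>s. (f (x + s *\<^sub>R b + s *\<^sub>R a) - f (x + s *\<^sub>R b) - f (x + s *\<^sub>R a) + f x) / s\<^sup>2)
     = (\<lambda>s. (f (x + s *\<^sub>R a + s *\<^sub>R b) - f (x + s *\<^sub>R a) - f (x + s *\<^sub>R b) + f x) / s\<^sup>2)"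
    by (simp add: algebra_simps)
  show ?thesis
    using tendsto_unique[OF _ second_difference_quotient[OF r(1) f p, of b a, unfolded e]
        second_difference_quotient[OF r(1) f p, of a b]] by simp
qed

text \<open>Inside the domain this is symmetry of second derivatives; it extends to the boundary because the
  second derivatives are continuous up to the boundary.\<close>

lemma hess_symmetric:
  assumes "open \<Omega>" "C_on 2 (closure \<Omega>) f" "x \<in> closure \<Omega>"
  shows "hess (closure \<Omega>) f x $ i $ j = hess (closure \<Omega>) f x $ j $ i"
proof -
  let ?d = "\<lambda>x. hess (closure \<Omega>) f x $ i $ j - hess (closure \<Omega>) f x $ j $ i"
  have at: "at y within closure \<Omega> = at y" if "y \<in> \<Omega>" for y
    using at_within_open_subset[OF that assms(1) closure_subset] .
  have in0: "?d y = 0" if y: "y \<in> \<Omega>" for y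
  proof -
    have "y \<in> closure \<Omega>" using y closure_subset by blast
    have "(f has_derivative (\<lambda>h. grad (closure \<Omega>) f z \<bullet> h)) (at z)" if "z \<in> \<Omega>" for z
      using C_on_2_grad[OF assms(2), of z] that closure_subset by (auto simp: at)
    moreover have "(grad (closure \<Omega>) f has_derivative (\<lambda>h. hess (closure \<Omega>) f y *v h)) (at y)"
      using C_on_2_hess[OF assms(2) \<open>y \<in> closure \<Omega>\<close>] y by (simp add: at)
    ultimately have "(hess (closure \<Omega>) f y *v axis j 1) \<bullet> axis i 1 = (hess (closure \<Omega>) f y *v axis i 1) \<bullet> axis j 1"
      using second_derivative_symmetric[OF assms(1) y] by blast
    then show ?thesis by (simp add: inner_axis matrix_vector_mul_component)
  qed
  have "continuous_on (closure \<Omega>) ?d"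
    by (intro continuous_intros continuous_on_component C_on_2_cont_hess[OF assms(2)])
  from continuous_constant_on_closure[OF this in0 assms(3)] show ?thesis by simp
qed

section \<open>The inward normal and tangential derivatives\<close>

lemma local_defining_function_grad:
  assumes "local_defining_function (Suc k) \<Omega> x U \<rho>" "y \<in> U"
  shows "(\<rho> has_derivative (\<lambda>h. grad U \<rho> y \<bullet> h)) (at y)"
proof -
  have "\<rho> differentiable (at y within U)" "open U"
    using assms by (auto simp: local_defining_function_def differentiable_on_def)
  with has_derivative_grad[OF this(1)] show ?thesis
    using at_within_open[OF assms(2)] by simp
qed

lemma local_defining_function_iff:
  "local_defining_function k \<Omega> x U \<rho> \<Longrightarrow> y \<in> U \<Longrightarrow> y \<in> \<Omega> \<longleftrightarrow> 0 < \<rho> y"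
  unfolding local_defining_function_def by blast

lemma local_defining_function_frontier:
  assumes "open \<Omega>" "local_defining_function (Suc k) \<Omega> x U \<rho>" "y \<in> U" "y \<in> frontier \<Omega>"
  shows "\<rho> y = 0"
proof (rule antisym)
  have U: "open U" using assms(2) by (simp add: local_defining_function_def)
  note iff = local_defining_function_iff[OF assms(2)]
  have "y \<notin> \<Omega>" using assms(1,4) by (simp add: frontier_def interior_open)
  then show "\<rho> y \<le> 0" using iff[OF assms(3)] by simp
  show "0 \<le> \<rho> y"
  proof -
    have c: "isCont \<rho> y"
      by (rule has_derivative_continuous[OF local_defining_function_grad[OF assms(2,3)]])
    obtain z where z: "\<And>n. z n \<in> \<Omega>" "z \<longlonglongrightarrow> y"
      using assms(4) unfolding frontier_def using closure_sequential by blast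
    have "\<forall>\<^sub>F n in sequentially. 0 \<le> \<rho> (z n)"
      using topological_tendstoD[OF z(2) U assms(3)]
    proof eventually_elim
      case (elim n)
      then show ?case using iff[of "z n"] z(1)[of n] by simp
    qed
    then show ?thesis
      using tendsto_lowerbound[OF isCont_tendsto_compose[OF c z(2)]] by simp
  qed
qed

lemma local_defining_function_side:
  assumes "open \<Omega>" "local_defining_function (Suc k) \<Omega> x U \<rho>" "x \<in> frontier \<Omega>"
  shows local_defining_function_inside:
      "grad U \<rho> x \<bullet> d > 0 \<Longrightarrow> \<forall>\<^sub>F s in at_right 0. x + s *\<^sub>R d \<in> \<Omega>"
    and local_defining_function_outside:
      "grad U \<rho> x \<bullet> d < 0 \<Longrightarrow> \<forall>\<^sub>F s in at_right 0. x + s *\<^sub>R d \<notin> \<Omega>"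
proof -
  have U: "open U" "x \<in> U" using assms(2) by (simp_all add: local_defining_function_def)
  note iff = local_defining_function_iff[OF assms(2)]
  have l: "((\<lambda>s. x + s *\<^sub>R d) has_derivative (\<lambda>h. h *\<^sub>R d)) (at 0)"
    by (auto intro!: derivative_eq_intros)
  have "((\<lambda>s. \<rho> (x + s *\<^sub>R d)) has_derivative (\<lambda>h. grad U \<rho> x \<bullet> (h *\<^sub>R d))) (at 0)"
    using has_derivative_compose[OF l, of \<rho> "\<lambda>h. grad U \<rho> x \<bullet> h"] local_defining_function_grad[OF assms(2) U(2)]
    by simp
  then have der: "((\<lambda>s. \<rho> (x + s *\<^sub>R d)) has_real_derivative grad U \<rho> x \<bullet> d) (at 0)"
    unfolding has_field_derivative_def by (rule has_derivative_eq_rhs) (auto simp: mult.commute)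
  have z: "\<rho> x = 0" using local_defining_function_frontier[OF assms(1,2) U(2) assms(3)] .
  have "((\<lambda>s. x + s *\<^sub>R d) \<longlongrightarrow> x + 0 *\<^sub>R d) (at_right 0)" by (intro tendsto_intros)
  then have inU: "\<forall>\<^sub>F s in at_right 0. x + s *\<^sub>R d \<in> U"
    using topological_tendstoD[OF _ U(1)] U(2) by fastforce
  { assume "grad U \<rho> x \<bullet> d > 0"
    from DERIV_pos_inc_right[OF der this] obtain m where "m > 0" "\<And>h. h > 0 \<Longrightarrow> h < m \<Longrightarrow> 0 < \<rho> (x + h *\<^sub>R d)"
      using z by auto
    then have "\<forall>\<^sub>F s in at_right 0. 0 < \<rho> (x + s *\<^sub>R d)"
      unfolding eventually_at_right_field by (intro exI[of _ m]) auto
    then show "\<forall>\<^sub>F s in at_right 0. x + s *\<^sub>R d \<in> \<Omega>"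
      using inU
    proof eventually_elim
      case (elim s)
      then show ?case using iff by simp
    qed }
  { assume "grad U \<rho> x \<bullet> d < 0"
    from DERIV_neg_dec_right[OF der this] obtain m where "m > 0" "\<And>h. h > 0 \<Longrightarrow> h < m \<Longrightarrow> 0 > \<rho> (x + h *\<^sub>R d)"
      using z by auto
    then have "\<forall>\<^sub>F s in at_right 0. 0 > \<rho> (x + s *\<^sub>R d)"
      unfolding eventually_at_right_field by (intro exI[of _ m]) auto
    then show "\<forall>\<^sub>F s in at_right 0. x + s *\<^sub>R d \<notin> \<Omega>"
      using inU
    proof eventually_elim
      case (elim s)
      then show ?case using iff by simp
    qed }
qed

text \<open>Two defining functions with different unit normals \<open>\<nu>\<close> and \<open>n\<close> are incompatible: the ray in the
  direction \<open>\<nu> - n\<close> would start inside the domain for one of them and outside for the other.\<close>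

lemma inward_normal_eq:
  assumes "open \<Omega>" "x \<in> frontier \<Omega>" and \<rho>: "local_defining_function 3 \<Omega> x U \<rho>"
  shows "inward_normal \<Omega> x = sgn (grad U \<rho> x)"
  unfolding inward_normal_def
proof (rule the_equality)
  show "\<exists>U' \<rho>'. local_defining_function 3 \<Omega> x U' \<rho>' \<and> sgn (grad U \<rho> x) = sgn (grad U' \<rho>' x)"
    using \<rho> by blast
next
  fix \<nu> assume "\<exists>U \<rho>. local_defining_function 3 \<Omega> x U \<rho> \<and> \<nu> = sgn (grad U \<rho> x)"
  then obtain V \<sigma> where \<sigma>: "local_defining_function 3 \<Omega> x V \<sigma>" and \<nu>: "\<nu> = sgn (grad V \<sigma> x)" by blast
  let ?n = "sgn (grad U \<rho> x)" and ?d = "\<nu> - sgn (grad U \<rho> x)"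
  have nz: "grad U \<rho> x \<noteq> 0" "grad V \<sigma> x \<noteq> 0"
    using \<rho> \<sigma> by (auto simp: local_defining_function_def)
  have n: "?n \<bullet> ?n = 1" "\<nu> \<bullet> \<nu> = 1" using nz by (simp_all add: \<nu> norm_sgn dot_square_norm)
  show "\<nu> = ?n"
  proof (rule ccontr)
    assume "\<nu> \<noteq> ?n"
    then have "0 < ?d \<bullet> ?d" by simp
    moreover have "?d \<bullet> ?d = 2 * (1 - \<nu> \<bullet> ?n)"
      using n by (simp add: inner_diff_left inner_diff_right inner_commute del: dot_square_norm)
    ultimately have "0 < 2 * (1 - \<nu> \<bullet> ?n)" by metis
    then have "\<nu> \<bullet> ?n < 1" by simp
    then have "?d \<bullet> \<nu> > 0" "?d \<bullet> ?n < 0"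
      using n by (simp_all add: inner_diff_left inner_diff_right inner_commute)
    then have "grad V \<sigma> x \<bullet> ?d > 0" "grad U \<rho> x \<bullet> ?d < 0"
      using nz by (simp_all add: \<nu> sgn_div_norm inner_commute zero_less_mult_iff mult_less_0_iff)
    then have "\<forall>\<^sub>F s in at_right 0. x + s *\<^sub>R ?d \<in> \<Omega>" "\<forall>\<^sub>F s in at_right 0. x + s *\<^sub>R ?d \<notin> \<Omega>"
      using local_defining_function_inside[of \<Omega> 2 x V \<sigma>] local_defining_function_outside[of \<Omega> 2 x U \<rho>]
        assms \<sigma> by (auto simp: numeral_3_eq_3 numeral_2_eq_2)
    then have "\<forall>\<^sub>F s in at_right (0::real). False"
      by eventually_elim blast
    then show False by (simp add: trivial_limit_at_right_real)
  qed
qed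

lemma
  assumes dom: "bounded_domain_of_class 3 \<Omega>" and x: "x \<in> frontier \<Omega>"
  shows norm_inward_normal: "norm (inward_normal \<Omega> x) = 1"
    and inward_normal_inside: "d \<bullet> inward_normal \<Omega> x > 0 \<Longrightarrow> \<forall>\<^sub>F s in at_right 0. x + s *\<^sub>R d \<in> \<Omega>"
    and inward_normal_outside: "d \<bullet> inward_normal \<Omega> x < 0 \<Longrightarrow> \<forall>\<^sub>F s in at_right 0. x + s *\<^sub>R d \<notin> \<Omega>"
    and inward_normal_differentiable: "inward_normal \<Omega> differentiable (at x within frontier \<Omega>)"
proof -
  have op: "open \<Omega>" using dom by (simp add: bounded_domain_of_class_def)
  obtain U \<rho> where \<rho>: "local_defining_function 3 \<Omega> x U \<rho>"
    using dom x unfolding bounded_domain_of_class_def by blast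
  then have \<rho>': "local_defining_function (Suc 2) \<Omega> x U \<rho>" by (simp add: numeral_3_eq_3 numeral_2_eq_2)
  have U: "open U" "x \<in> U" "C_on (Suc (Suc (Suc 0))) U \<rho>" "\<And>y. y \<in> U \<Longrightarrow> grad U \<rho> y \<noteq> 0"
    using \<rho> unfolding local_defining_function_def numeral_3_eq_3 by blast+
  have eq: "inward_normal \<Omega> y = sgn (grad U \<rho> y)" if "y \<in> U" "y \<in> frontier \<Omega>" for y
  proof (rule inward_normal_eq[OF op that(2)])
    show "local_defining_function 3 \<Omega> y U \<rho>"
      using \<rho> that(1) by (simp add: local_defining_function_def)
  qed
  have eqx: "inward_normal \<Omega> x = sgn (grad U \<rho> x)" and nz: "grad U \<rho> x \<noteq> 0" using eq U x by auto
  show "norm (inward_normal \<Omega> x) = 1" using eqx nz by (simp add: norm_sgn)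
  show "d \<bullet> inward_normal \<Omega> x > 0 \<Longrightarrow> \<forall>\<^sub>F s in at_right 0. x + s *\<^sub>R d \<in> \<Omega>"
    using local_defining_function_inside[OF op \<rho>' x, of d] nz
    by (simp add: eqx sgn_div_norm inner_commute zero_less_mult_iff)
  show "d \<bullet> inward_normal \<Omega> x < 0 \<Longrightarrow> \<forall>\<^sub>F s in at_right 0. x + s *\<^sub>R d \<notin> \<Omega>"
    using local_defining_function_outside[OF op \<rho>' x, of d] nz
    by (simp add: eqx sgn_div_norm inner_commute mult_less_0_iff)
  have "C_on 2 U \<rho>" using C_on_Suc_imp[OF U(3)] by (simp add: numeral_2_eq_2)
  then have "grad U \<rho> differentiable (at x)"
    using C_on_2_hess U(1,2) at_within_open[OF U(2,1)] by (metis differentiable_def)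
  moreover have "norm differentiable at (grad U \<rho> x)"
    using nz differentiable_norm_at by blast
  ultimately have "(\<lambda>y. norm (grad U \<rho> y)) differentiable (at x)"
    using differentiable_compose by blast
  then have "(\<lambda>y. grad U \<rho> y /\<^sub>R norm (grad U \<rho> y)) differentiable (at x)"
    using nz \<open>grad U \<rho> differentiable (at x)\<close>
    by (intro differentiable_scaleR differentiable_inverse) auto
  then have "(\<lambda>y. sgn (grad U \<rho> y)) differentiable (at x within frontier \<Omega>)"
    by (simp add: sgn_div_norm differentiable_at_withinI)
  then obtain D where D: "((\<lambda>y. sgn (grad U \<rho> y)) has_derivative D) (at x within frontier \<Omega>)"
    by (auto simp: differentiable_def)
  have "\<forall>\<^sub>F y in at x within frontier \<Omega>. inward_normal \<Omega> y = sgn (grad U \<rho> y)"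
    unfolding eventually_at_topological using eq U(1,2) by blast
  then have "\<forall>\<^sub>F y in at x within frontier \<Omega>. sgn (grad U \<rho> y) = inward_normal \<Omega> y"
    by (rule eventually_mono) simp
  from has_derivative_transform_eventually[OF D this] eqx x
  show "inward_normal \<Omega> differentiable (at x within frontier \<Omega>)"
    by (auto simp: differentiable_def)
qed

text \<open>The boundary contains points \<open>x + s (\<tau> + c N)\<close> with \<open>s \<rightarrow> 0\<close> and \<open>c\<close> as small as desired, since the
  segment from \<open>x + s (\<tau> + \<eta> N)\<close> to \<open>x + s (\<tau> - \<eta> N)\<close> leaves the domain.\<close>

lemma boundary_points_along_tangent:
  assumes dom: "bounded_domain_of_class 3 \<Omega>" and x: "x \<in> frontier \<Omega>"
    and \<tau>: "\<tau> \<bullet> inward_normal \<Omega> x = 0" and \<eta>: "0 < \<eta>"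
  shows "\<forall>\<^sub>F s in at_right 0. \<exists>c. \<bar>c\<bar> \<le> \<eta> \<and> x + s *\<^sub>R (\<tau> + c *\<^sub>R inward_normal \<Omega> x) \<in> frontier \<Omega>"
proof -
  let ?N = "inward_normal \<Omega> x"
  have N: "?N \<bullet> ?N = 1" using norm_inward_normal[OF dom x] by (simp add: dot_square_norm)
  have "(\<tau> + \<eta> *\<^sub>R ?N) \<bullet> ?N > 0" "(\<tau> - \<eta> *\<^sub>R ?N) \<bullet> ?N < 0"
    using \<tau> \<eta> N by (simp_all add: inner_add_left inner_diff_left)
  from inward_normal_inside[OF dom x this(1)] inward_normal_outside[OF dom x this(2)]
  show ?thesis
  proof eventually_elim
    case (elim s)
    let ?L = "(\<lambda>c. x + s *\<^sub>R (\<tau> + c *\<^sub>R ?N)) ` {-\<eta>..\<eta>}"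
    have "connected ?L"
      by (intro connected_continuous_image continuous_intros) auto
    moreover have "?L \<inter> \<Omega> \<noteq> {}" using elim(1) \<eta> by (auto intro!: image_eqI[of _ _ \<eta>])
    moreover have "x + s *\<^sub>R (\<tau> - \<eta> *\<^sub>R ?N) \<in> ?L"
      using \<eta> by (auto intro!: image_eqI[of _ _ "-\<eta>"])
    then have "?L - \<Omega> \<noteq> {}" using elim(2) by blast
    ultimately have "?L \<inter> frontier \<Omega> \<noteq> {}" by (rule connected_Int_frontier)
    then show ?case by (auto simp: abs_le_iff minus_le_iff)
  qed
qed

text \<open>A derivative relative to the boundary is determined by the function in tangential directions, by
  the boundary points of the preceding lemma. Identities that hold on the boundary may therefore be
  differentiated along the tangent, whichever relative derivatives are chosen.\<close>

lemma derivative_along_tangent_zero: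
  fixes h :: "real^2 \<Rightarrow> real"
  assumes dom: "bounded_domain_of_class 3 \<Omega>" and x: "x \<in> frontier \<Omega>"
    and \<tau>: "\<tau> \<bullet> inward_normal \<Omega> x = 0"
    and h: "(h has_derivative h') (at x within frontier \<Omega>)" and h0: "\<And>y. y \<in> frontier \<Omega> \<Longrightarrow> h y = 0"
  shows "h' \<tau> = 0"
proof -
  let ?N = "inward_normal \<Omega> x"
  interpret h': bounded_linear h' using h has_derivative_bounded_linear by blast
  have N: "norm ?N = 1" using norm_inward_normal[OF dom x] .
  have "\<bar>h' \<tau>\<bar> \<le> \<eta> * (norm \<tau> + 1 + \<bar>h' ?N\<bar>)" if \<eta>: "0 < \<eta>" "\<eta> < 1" for \<eta>
  proof -
    obtain d where d: "d > 0" "\<And>y. y \<in> frontier \<Omega> \<Longrightarrow> norm (y - x) < d \<Longrightarrow>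
        norm (h y - h x - h' (y - x)) \<le> \<eta> * norm (y - x)"
      using h \<eta>(1) unfolding has_derivative_within_alt by blast
    define m where "m = d / (norm \<tau> + 1)"
    have q: "norm \<tau> + 1 > 0" by (simp add: add_nonneg_pos)
    have m: "m > 0" using d(1) q by (simp add: m_def)
    have "\<forall>\<^sub>F s in at_right 0. 0 < s \<and> s < m"
      unfolding eventually_at_right_field using m by (intro exI[of _ m]) auto
    with boundary_points_along_tangent[OF dom x \<tau> \<eta>(1)]
    have "\<forall>\<^sub>F s in at_right 0. \<exists>c. \<bar>c\<bar> \<le> \<eta> \<and> x + s *\<^sub>R (\<tau> + c *\<^sub>R ?N) \<in> frontier \<Omega> \<and> 0 < s \<and> s < m"
      by eventually_elim blast
    then obtain s c where sc: "\<bar>c\<bar> \<le> \<eta>" "x + s *\<^sub>R (\<tau> + c *\<^sub>R ?N) \<in> frontier \<Omega>" "0 < s" "s < m"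
      using eventually_happens'[OF trivial_limit_at_right_real] by blast
    let ?w = "\<tau> + c *\<^sub>R ?N"
    have w: "norm ?w \<le> norm \<tau> + 1"
      using norm_triangle_ineq[of \<tau> "c *\<^sub>R ?N"] N sc(1) \<eta>(2) by simp
    have "norm (s *\<^sub>R ?w) = s * norm ?w" using sc(3) by simp
    also have "\<dots> \<le> s * (norm \<tau> + 1)" using w sc(3) by (intro mult_left_mono) auto
    also have "\<dots> < d" using sc(4) q by (simp add: m_def pos_less_divide_eq)
    finally have "\<bar>h' (s *\<^sub>R ?w)\<bar> \<le> \<eta> * norm (s *\<^sub>R ?w)"
      using d(2)[OF sc(2)] h0[OF sc(2)] h0[OF x] by simp
    then have "s * \<bar>h' ?w\<bar> \<le> s * (\<eta> * norm ?w)"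
      using sc(3) by (simp add: h'.scale abs_mult)
    then have "\<bar>h' ?w\<bar> \<le> \<eta> * norm ?w" using sc(3) by simp
    also have "\<dots> \<le> \<eta> * (norm \<tau> + 1)" using w \<eta> by (intro mult_left_mono) auto
    finally have 1: "\<bar>h' ?w\<bar> \<le> \<eta> * (norm \<tau> + 1)" .
    have "h' \<tau> = h' ?w - c * h' ?N" by (simp add: h'.add h'.scale)
    moreover have "\<bar>c * h' ?N\<bar> \<le> \<eta> * \<bar>h' ?N\<bar>"
      using sc(1) by (simp add: abs_mult mult_right_mono)
    ultimately show ?thesis using 1 by (simp add: algebra_simps)
  qed
  then have "\<forall>\<^sub>F \<eta> in at_right 0. \<bar>h' \<tau>\<bar> \<le> \<eta> * (norm \<tau> + 1 + \<bar>h' ?N\<bar>)"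
    unfolding eventually_at_right_field by (intro exI[of _ 1]) auto
  moreover have "((\<lambda>\<eta>. \<eta> * (norm \<tau> + 1 + \<bar>h' ?N\<bar>)) \<longlongrightarrow> 0 * (norm \<tau> + 1 + \<bar>h' ?N\<bar>)) (at_right 0)"
    by (intro tendsto_intros)
  ultimately have "\<bar>h' \<tau>\<bar> \<le> 0 * (norm \<tau> + 1 + \<bar>h' ?N\<bar>)"
    by (intro tendsto_lowerbound[of _ _ "at_right (0::real)"]) auto
  then show ?thesis by simp
qed

section \<open>The anisotropic coefficients\<close>

definition flow_matrix :: "(real^3 \<Rightarrow> real) \<Rightarrow> (real^3 \<Rightarrow> real) \<Rightarrow> real^2 \<Rightarrow> real^2^2" where
  "flow_matrix F G q = G (graph_normal q) *\<^sub>R D2p F (graph_normal q)"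

definition lift3 :: "real^2 \<Rightarrow> real^3" where
  "lift3 \<nu> = (\<Sum>i\<in>UNIV. \<nu> $ i *\<^sub>R e3 i)"

lemma e3_in_Basis: "e3 i \<in> Basis"
  by (auto simp: e3_def Basis_vec_def)

lemma inner_e3: "e3 i \<bullet> e3 j = (if i = j then 1 else 0)"
proof -
  have "i = 1 \<or> i = 2" "j = 1 \<or> j = 2" using exhaust_2 by auto
  then show ?thesis by (auto simp: e3_def inner_axis_axis)
qed

lemma inner_graph_normal_lift3: "graph_normal q \<bullet> lift3 \<nu> = q \<bullet> \<nu>"
  by (simp add: lift3_def sum_2 sum_3 e3_def axis_def graph_normal_def inner_vec_def)

lemma norm_graph_normal: "norm (graph_normal q) = sqrt (1 + (norm q)\<^sup>2)"
  by (simp add: norm_eq_sqrt_inner inner_vec_def sum_2 sum_3 graph_normal_def)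

lemma graph_normal_nonzero: "graph_normal q \<noteq> 0"
proof -
  have "0 < 1 + (norm q)\<^sup>2" by (simp add: add_pos_nonneg)
  then have "0 < norm (graph_normal q)" unfolding norm_graph_normal by simp
  then show ?thesis by auto
qed

lemma continuous_graph_normal: "continuous_on UNIV graph_normal"
proof -
  have eq: "graph_normal = (\<lambda>q. q $ 1 *\<^sub>R axis 1 1 + q $ 2 *\<^sub>R axis 2 1 - axis 3 1)"
    by (auto simp: graph_normal_def vec_eq_iff axis_def forall_3)
  show ?thesis by (subst eq) (intro continuous_intros continuous_on_component)
qed

lemma smooth_away_from_origin:
  assumes "smooth_on (- {0::real^3}) F" "p \<noteq> 0"
  shows smooth_away_grad: "(F has_derivative (\<lambda>h. grad UNIV F p \<bullet> h)) (at p)"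
    and smooth_away_pd: "b \<in> Basis \<Longrightarrow>
      (pd UNIV b F has_derivative (\<lambda>h. grad UNIV (pd UNIV b F) p \<bullet> h)) (at p)"
    and smooth_away_cont: "b \<in> Basis \<Longrightarrow> c \<in> Basis \<Longrightarrow> continuous_on (- {0}) (pd UNIV c (pd UNIV b F))"
proof -
  let ?S = "- {0::real^3}"
  have S: "open ?S" "p \<in> ?S" using assms(2) by auto
  have C: "C_on 2 ?S F" using assms(1) by (simp add: smooth_on_def)
  have d: "F differentiable_on ?S" "\<And>b. b \<in> Basis \<Longrightarrow> pd ?S b F differentiable_on ?S"
    "\<And>b c. b \<in> Basis \<Longrightarrow> c \<in> Basis \<Longrightarrow> continuous_on ?S (pd ?S c (pd ?S b F))"
    using C by (auto simp: numeral_2_eq_2)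
  have at: "at x within ?S = at x" if "x \<in> ?S" for x
    using at_within_open[OF that S(1)] .
  have pd1: "pd ?S b f x = pd UNIV b f x" if "x \<in> ?S" for b f x
    by (simp add: pd_def at[OF that])
  have "F differentiable (at p)" using d(1) S(2) at by (auto simp: differentiable_on_def)
  then show "(F has_derivative (\<lambda>h. grad UNIV F p \<bullet> h)) (at p)"
    using has_derivative_grad[of F p UNIV] by simp
  have dd: "pd UNIV b F differentiable (at x)" if b: "b \<in> Basis" and x: "x \<in> ?S" for b x
  proof -
    have "pd ?S b F differentiable (at x)" using d(2)[OF b] x at by (auto simp: differentiable_on_def)
    then obtain D where "(pd ?S b F has_derivative D) (at x)" by (auto simp: differentiable_def)
    then have "(pd UNIV b F has_derivative D) (at x)"
      using has_derivative_transform_within_open[OF _ S(1) x] pd1 by metis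
    then show ?thesis by (auto simp: differentiable_def)
  qed
  show "b \<in> Basis \<Longrightarrow> (pd UNIV b F has_derivative (\<lambda>h. grad UNIV (pd UNIV b F) p \<bullet> h)) (at p)"
    using has_derivative_grad[of "pd UNIV b F" p UNIV] dd[OF _ S(2)] by simp
  show "b \<in> Basis \<Longrightarrow> c \<in> Basis \<Longrightarrow> continuous_on ?S (pd UNIV c (pd UNIV b F))"
  proof -
    assume b: "b \<in> Basis" "c \<in> Basis"
    have "pd ?S c (pd ?S b F) x = pd UNIV c (pd UNIV b F) x" if x: "x \<in> ?S" for x
    proof -
      have "pd UNIV c (pd ?S b F) x = pd UNIV c (pd UNIV b F) x"
        unfolding pd_def[of UNIV c]
        using frechet_derivative_transform_within_open[OF dd[OF b(1) x] S(1) x, of "pd ?S b F"] pd1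
        by simp
      then show ?thesis using pd1[OF x] by simp
    qed
    with continuous_on_eq[OF d(3)[OF b]] show ?thesis by blast
  qed
qed

lemma pd_has_derivative: "(f has_derivative f') (at x) \<Longrightarrow> pd UNIV v f x = f' v"
  unfolding pd_def using frechet_derivative_at by metis

lemma Dp_eq: "Dp i F = pd UNIV (e3 i) F"
  by (simp add: Dp_def fun_eq_iff)

lemma inner_matrix_sum: "\<nu> \<bullet> (A *v \<nu>) = (\<Sum>i\<in>UNIV. \<Sum>j\<in>UNIV. \<nu> $ i * \<nu> $ j * A $ i $ j)"
  for \<nu> :: "real^2"
  by (simp add: inner_vec_def matrix_vector_mult_def sum_2 algebra_simps)

text \<open>The second difference quotients of a convex function are nonnegative.\<close>

lemma D2p_psd:
  assumes "smooth_on (- {0}) F" "convex_on UNIV F" "P \<noteq> 0"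
  shows "0 \<le> \<nu> \<bullet> (D2p F P *v \<nu>)"
proof -
  let ?w = "lift3 \<nu>"
  define H where "H h = (\<Sum>b\<in>Basis. (grad UNIV (pd UNIV b F) P \<bullet> h) *\<^sub>R b)" for h
  have b: "P \<in> - {0}" "open (- {0::real^3})" using assms(3) by auto
  obtain r where r: "0 < r" "ball P r \<subseteq> - {0}" using b open_contains_ball by blast
  have 1: "(F has_derivative (\<lambda>h. grad UNIV F y \<bullet> h)) (at y)" if "y \<in> ball P r" for y
    using smooth_away_grad[OF assms(1)] r(2) that by blast
  have grad_eq: "grad UNIV F = (\<lambda>x. \<Sum>b\<in>Basis. pd UNIV b F x *\<^sub>R b)"
    by (simp add: grad_def fun_eq_iff)
  have 2: "(grad UNIV F has_derivative H) (at P)"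
    unfolding grad_eq H_def[abs_def]
    by (intro has_derivative_sum has_derivative_scaleR_left smooth_away_pd[OF assms(1,3)])
  have lim: "((\<lambda>s. (F (P + s *\<^sub>R ?w + s *\<^sub>R ?w) - F (P + s *\<^sub>R ?w) - F (P + s *\<^sub>R ?w) + F P) / s\<^sup>2)
      \<longlongrightarrow> H ?w \<bullet> ?w) (at_right 0)"
    by (rule second_difference_quotient[OF r(1) 1 2])
  have "0 \<le> (F (P + s *\<^sub>R ?w + s *\<^sub>R ?w) - F (P + s *\<^sub>R ?w) - F (P + s *\<^sub>R ?w) + F P) / s\<^sup>2" for s
  proof -
    have "F ((1 - 1/2) *\<^sub>R P + (1/2) *\<^sub>R (P + s *\<^sub>R ?w + s *\<^sub>R ?w))
        \<le> (1 - 1/2) * F P + (1/2) * F (P + s *\<^sub>R ?w + s *\<^sub>R ?w)"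
      using assms(2) by (intro convex_onD) auto
    moreover have "(1 - 1/2) *\<^sub>R P + (1/2) *\<^sub>R (P + s *\<^sub>R ?w + s *\<^sub>R ?w) = P + s *\<^sub>R ?w"
      by (simp add: vec_eq_iff field_simps)
    ultimately show ?thesis by (intro divide_nonneg_nonneg) auto
  qed
  then have "0 \<le> H ?w \<bullet> ?w"
    by (intro tendsto_lowerbound[OF lim]) (auto intro: always_eventually)
  also have "H ?w \<bullet> ?w = \<nu> \<bullet> (D2p F P *v \<nu>)"
  proof -
    have "H ?w \<bullet> e3 i = grad UNIV (Dp i F) P \<bullet> ?w" for i
      by (simp add: H_def inner_sum_left inner_Basis e3_in_Basis if_distrib sum.delta Dp_eq cong: if_cong)
    moreover have "grad UNIV (Dp i F) P \<bullet> e3 j = D2p F P $ i $ j" for i j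
      using pd_has_derivative[OF smooth_away_pd[OF assms(1,3) e3_in_Basis[of i]], of "e3 j"]
      by (simp add: D2p_def Dp_eq)
    ultimately show ?thesis
      by (simp add: lift3_def inner_matrix_sum sum_2 inner_add_right algebra_simps)
  qed
  finally show ?thesis .
qed

lemma F_xi_eq:
  assumes "positive_homogeneous_smooth F" "p \<noteq> 0"
  shows "F_xi F p = F p * inverse (norm p)"
proof -
  have "inverse (norm p) > 0" using assms(2) by simp
  then show ?thesis
    using assms(1) unfolding F_xi_def positive_homogeneous_smooth_def by (simp add: mult.commute)
qed

lemma has_derivative_inverse_norm:
  fixes p :: "'a::euclidean_space"
  assumes "p \<noteq> 0"
  shows "((\<lambda>q. inverse (norm q)) has_derivative (\<lambda>h. - (p \<bullet> h) * inverse (norm p) ^ 3)) (at p)"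
  by (rule has_derivative_eq_rhs[OF Deriv.has_derivative_inverse[OF _ has_derivative_norm[OF assms]]])
     (use assms in \<open>simp_all add: fun_eq_iff sgn_div_norm power3_eq_cube inner_commute\<close>)

lemma Dp_F_xi:
  assumes F: "positive_homogeneous_smooth F" and p: "p \<noteq> 0"
  shows "Dp i (F_xi F) p = Dp i F p * inverse (norm p) - F p * (p \<bullet> e3 i) * inverse (norm p) ^ 3"
proof -
  have sm: "smooth_on (- {0}) F" using F by (simp add: positive_homogeneous_smooth_def)
  let ?D = "\<lambda>h. F p * (- (p \<bullet> h) * inverse (norm p) ^ 3) + (grad UNIV F p \<bullet> h) * inverse (norm p)"
  have "((\<lambda>q. F q * inverse (norm q)) has_derivative ?D) (at p)"
    by (rule has_derivative_mult[OF smooth_away_grad[OF sm p] has_derivative_inverse_norm[OF p]])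
  then have "(F_xi F has_derivative ?D) (at p)"
    by (rule has_derivative_transform_within_open[of _ _ _ _ "- {0}"]) (use p F_xi_eq[OF F] in auto)
  from pd_has_derivative[OF this] have "Dp i (F_xi F) p = ?D (e3 i)" by (simp add: Dp_eq)
  moreover have "Dp i F p = grad UNIV F p \<bullet> e3 i"
    using pd_has_derivative[OF smooth_away_grad[OF sm p]] by (simp add: Dp_eq)
  ultimately show ?thesis by simp
qed

lemma D2p_F_xi:
  assumes F: "positive_homogeneous_smooth F" and p: "p \<noteq> 0"
  shows "D2p (F_xi F) p $ i $ j = D2p F p $ i $ j * inverse (norm p)
    - (Dp i F p * (p \<bullet> e3 j) + Dp j F p * (p \<bullet> e3 i) + F p * (e3 i \<bullet> e3 j)) * inverse (norm p) ^ 3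
    + 3 * F p * (p \<bullet> e3 i) * (p \<bullet> e3 j) * inverse (norm p) ^ 5"
proof -
  have sm: "smooth_on (- {0}) F" using F by (simp add: positive_homogeneous_smooth_def)
  let ?I = "inverse (norm p)"
  have D1: "(Dp i F has_derivative (\<lambda>h. grad UNIV (Dp i F) p \<bullet> h)) (at p)"
    using smooth_away_pd[OF sm p e3_in_Basis] by (simp add: Dp_eq)
  note D0 = smooth_away_grad[OF sm p]
  note DI = has_derivative_inverse_norm[OF p]
  let ?D = "\<lambda>h. (grad UNIV (Dp i F) p \<bullet> h) * ?I - Dp i F p * (p \<bullet> h) * ?I ^ 3
     - ((grad UNIV F p \<bullet> h) * (p \<bullet> e3 i) + F p * (h \<bullet> e3 i)) * ?I ^ 3
     + 3 * F p * (p \<bullet> e3 i) * (p \<bullet> h) * ?I ^ 5"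
  have "((\<lambda>q. Dp i F q * inverse (norm q) - F q * (q \<bullet> e3 i) * inverse (norm q) ^ 3) has_derivative ?D) (at p)"
    by (rule has_derivative_eq_rhs, (rule derivative_intros D1 D0 DI)+)
       (simp add: fun_eq_iff algebra_simps power_numeral_reduce)
  then have "(Dp i (F_xi F) has_derivative ?D) (at p)"
    by (rule has_derivative_transform_within_open[of _ _ _ _ "- {0}"]) (use p Dp_F_xi[OF F] in auto)
  from pd_has_derivative[OF this] have "D2p (F_xi F) p $ i $ j = ?D (e3 j)" by (simp add: Dp_eq D2p_def)
  moreover have "Dp j F p = grad UNIV F p \<bullet> e3 j"
    using pd_has_derivative[OF D0] by (simp add: Dp_eq)
  moreover have "D2p F p $ i $ j = grad UNIV (Dp i F) p \<bullet> e3 j"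
    using pd_has_derivative[OF D1] by (simp add: Dp_eq D2p_def)
  ultimately show ?thesis by (simp add: algebra_simps inner_commute)
qed

text \<open>Take second derivatives of \<open>F(p) = \<bar>p\<bar> F(\<xi>)\<close> in a direction orthogonal to \<open>p\<close>: \<open>\<bar>p\<bar>\<close> has vanishing
  first and second derivative \<open>\<bar>\<nu>\<bar>\<^sup>2 / \<bar>p\<bar>\<close> there, so that the first derivatives of \<open>F(\<xi>)\<close>, which are not
  small, drop out.\<close>

lemma D2p_F_xi_orthogonal:
  assumes F: "positive_homogeneous_smooth F" and p: "p \<noteq> 0" and orth: "p \<bullet> lift3 \<nu> = 0"
  shows "\<nu> \<bullet> (D2p F p *v \<nu>) = norm p * (\<nu> \<bullet> (D2p (F_xi F) p *v \<nu>)) + F_xi F p * (norm \<nu>)\<^sup>2 / norm p"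
proof -
  define s where "s = p \<bullet> lift3 \<nu>"
  let ?I = "inverse (norm p)"
  have s: "s = \<nu> $ 1 * (p \<bullet> e3 1) + \<nu> $ 2 * (p \<bullet> e3 2)"
    by (simp add: s_def lift3_def sum_2 inner_add_right)
  define D where "D = \<nu> $ 1 * Dp 1 F p + \<nu> $ 2 * Dp 2 F p"
  have "\<nu> \<bullet> (D2p (F_xi F) p *v \<nu>) = (\<nu> \<bullet> (D2p F p *v \<nu>)) * ?I - (2 * s * D + F p * (\<nu> \<bullet> \<nu>)) * ?I ^ 3
      + 3 * F p * s\<^sup>2 * ?I ^ 5"
    unfolding inner_matrix_sum D2p_F_xi[OF F p]
    by (simp add: sum_2 s D_def inner_e3 inner_vec_def[of \<nu> \<nu>] algebra_simps power2_eq_square)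
  then have "\<nu> \<bullet> (D2p (F_xi F) p *v \<nu>) = (\<nu> \<bullet> (D2p F p *v \<nu>)) * ?I - F p * (norm \<nu>)\<^sup>2 * ?I ^ 3"
    using orth by (simp add: s_def[symmetric] power2_norm_eq_inner)
  then show ?thesis
    using p by (simp add: F_xi_eq[OF F p] field_simps power3_eq_cube power2_eq_square)
qed

text \<open>The Cauchy-Schwarz inequality for \<open>M\<close> and \<open>\<nu> \<otimes> \<nu>\<close>.\<close>

lemma frobenius_quadratic_form: "\<bar>\<nu> \<bullet> (M *v \<nu>)\<bar> \<le> frobenius_norm M * (norm \<nu>)\<^sup>2"
proof -
  have 1: "frobenius_norm M = sqrt ((M$1$1)\<^sup>2 + (M$1$2)\<^sup>2 + (M$2$1)\<^sup>2 + (M$2$2)\<^sup>2)"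
    by (simp add: frobenius_norm_def trace_def transpose_def matrix_matrix_mult_def sum_2 power2_eq_square
        algebra_simps)
  have "(\<nu> \<bullet> (M *v \<nu>))\<^sup>2 \<le> ((M$1$1)\<^sup>2 + (M$1$2)\<^sup>2 + (M$2$1)\<^sup>2 + (M$2$2)\<^sup>2) * ((\<nu>$1)\<^sup>2 + (\<nu>$2)\<^sup>2)\<^sup>2"
  proof -
    define x y a b c d where "x = \<nu>$1" "y = \<nu>$2" "a = M$1$1" "b = M$1$2" "c = M$2$1" "d = M$2$2"
    \<comment> \<open>Lagrange's identity\<close>
    have eq: "(a\<^sup>2 + b\<^sup>2 + c\<^sup>2 + d\<^sup>2) * (x\<^sup>2 + y\<^sup>2)\<^sup>2 - (x*x*a + x*y*b + y*x*c + y*y*d)\<^sup>2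
       = (a*x*y - b*x*x)\<^sup>2 + (a*x*y - c*x*x)\<^sup>2 + (a*y*y - d*x*x)\<^sup>2 + (b*x*y - c*x*y)\<^sup>2
         + (b*y*y - d*x*y)\<^sup>2 + (c*y*y - d*x*y)\<^sup>2"
      by (simp add: power2_eq_square algebra_simps)
    have "0 \<le> (a\<^sup>2 + b\<^sup>2 + c\<^sup>2 + d\<^sup>2) * (x\<^sup>2 + y\<^sup>2)\<^sup>2 - (x*x*a + x*y*b + y*x*c + y*y*d)\<^sup>2"
      unfolding eq by (intro add_nonneg_nonneg zero_le_power2)
    then have "(x*x*a + x*y*b + y*x*c + y*y*d)\<^sup>2 \<le> (a\<^sup>2 + b\<^sup>2 + c\<^sup>2 + d\<^sup>2) * (x\<^sup>2 + y\<^sup>2)\<^sup>2"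
      by (simp only: diff_ge_0_iff_ge)
    then show ?thesis by (simp add: inner_matrix_sum sum_2 x_y_a_b_c_d_def algebra_simps)
  qed
  then have "sqrt ((\<nu> \<bullet> (M *v \<nu>))\<^sup>2)
      \<le> sqrt (((M$1$1)\<^sup>2 + (M$1$2)\<^sup>2 + (M$2$1)\<^sup>2 + (M$2$2)\<^sup>2) * ((\<nu>$1)\<^sup>2 + (\<nu>$2)\<^sup>2)\<^sup>2)"
    by (rule real_sqrt_le_mono)
  moreover have "(norm \<nu>)\<^sup>2 = (\<nu>$1)\<^sup>2 + (\<nu>$2)\<^sup>2"
    unfolding power2_norm_eq_inner by (simp add: inner_vec_def sum_2 power2_eq_square)
  moreover have "\<bar>(\<nu>$1)\<^sup>2 + (\<nu>$2)\<^sup>2\<bar> = (\<nu>$1)\<^sup>2 + (\<nu>$2)\<^sup>2" by simp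
  ultimately show ?thesis by (simp only: 1 real_sqrt_mult real_sqrt_abs)
qed

text \<open>In the lower bound the factor \<open>\<bar>(q,-1)\<bar>\<close> of the homogeneous function \<open>G\<close> cancels the factor
  \<open>1 / \<bar>(q,-1)\<bar>\<close> of the second derivatives of \<open>F\<close>, so that the bound is uniform in \<open>q\<close>.\<close>

lemma
  assumes F: "positive_homogeneous_smooth F" "convex_on UNIV F" and G: "positive_homogeneous_smooth G"
  shows flow_matrix_cont: "continuous_on UNIV (flow_matrix F G)"
    and flow_matrix_psd: "0 \<le> \<nu> \<bullet> (flow_matrix F G q *v \<nu>)"
    and flow_matrix_orthogonal: "structure_bounds F G g0 G0 m0 M0 m1 m2 \<Longrightarrow> m2 < m0 \<Longrightarrow> q \<bullet> \<nu> = 0 \<Longrightarrow>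
      g0 * (m0 - m2) * (norm \<nu>)\<^sup>2 \<le> \<nu> \<bullet> (flow_matrix F G q *v \<nu>)"
proof -
  have smF: "smooth_on (- {0}) F" and smG: "smooth_on (- {0}) G"
    using F G by (auto simp: positive_homogeneous_smooth_def)
  let ?P = "graph_normal q"
  have GP: "0 < G ?P" using G graph_normal_nonzero by (auto simp: positive_homogeneous_smooth_def)
  have eq: "\<nu> \<bullet> (flow_matrix F G q *v \<nu>) = G ?P * (\<nu> \<bullet> (D2p F ?P *v \<nu>))"
    by (simp add: flow_matrix_def inner_matrix_sum sum_2 algebra_simps)
  show psd: "0 \<le> \<nu> \<bullet> (flow_matrix F G q *v \<nu>)"
    unfolding eq using GP D2p_psd[OF smF F(2) graph_normal_nonzero] by simp
  have range: "range graph_normal \<subseteq> - {0}" using graph_normal_nonzero by auto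
  have "C_on 0 (- {0}) G" using smG unfolding smooth_on_def by blast
  then have cG: "continuous_on (- {0}) G" by simp
  have cF: "continuous_on (- {0}) (D2p F)"
    unfolding D2p_def
    by (intro continuous_on_vec_lambda)
       (use smooth_away_cont[OF smF graph_normal_nonzero] e3_in_Basis in \<open>simp add: Dp_eq\<close>)
  show "continuous_on UNIV (flow_matrix F G)"
    unfolding flow_matrix_def[abs_def]
    by (intro continuous_on_scaleR continuous_on_compose2[OF cG continuous_graph_normal]
        continuous_on_compose2[OF cF continuous_graph_normal]) (use range in auto)
  assume sb: "structure_bounds F G g0 G0 m0 M0 m1 m2" and m: "m2 < m0" and orth: "q \<bullet> \<nu> = 0"
  let ?v = "norm ?P"
  have v: "0 < ?v" using graph_normal_nonzero by simp
  have b: "g0 \<le> F_xi G ?P" "m0 \<le> F_xi F ?P" "frobenius_norm (D2p (F_xi F) ?P) < m2 / ?v\<^sup>2" "0 < g0"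
    using sb graph_normal_nonzero unfolding structure_bounds_def by blast+
  have "g0 * ?v \<le> G ?P"
    using b(1) v unfolding F_xi_eq[OF G graph_normal_nonzero] by (simp add: field_simps)
  moreover have "(m0 - m2) * (norm \<nu>)\<^sup>2 / ?v \<le> \<nu> \<bullet> (D2p F ?P *v \<nu>)"
  proof -
    have "\<nu> \<bullet> (D2p (F_xi F) ?P *v \<nu>) \<ge> - (frobenius_norm (D2p (F_xi F) ?P) * (norm \<nu>)\<^sup>2)"
      using frobenius_quadratic_form[of \<nu> "D2p (F_xi F) ?P"] by linarith
    moreover have "frobenius_norm (D2p (F_xi F) ?P) * (norm \<nu>)\<^sup>2 \<le> m2 / ?v\<^sup>2 * (norm \<nu>)\<^sup>2"
      using b(3) by (intro mult_right_mono) auto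
    ultimately have "?v * (- (m2 / ?v\<^sup>2 * (norm \<nu>)\<^sup>2)) \<le> ?v * (\<nu> \<bullet> (D2p (F_xi F) ?P *v \<nu>))"
      using v by (intro mult_left_mono) auto
    moreover have "m0 * (norm \<nu>)\<^sup>2 / ?v \<le> F_xi F ?P * (norm \<nu>)\<^sup>2 / ?v"
      using b(2) v by (intro divide_right_mono mult_right_mono) auto
    moreover have "?v * (- (m2 / ?v\<^sup>2 * (norm \<nu>)\<^sup>2)) = - m2 * (norm \<nu>)\<^sup>2 / ?v"
      using v by (simp add: power2_eq_square)
    ultimately show ?thesis
      using D2p_F_xi_orthogonal[OF F(1) graph_normal_nonzero, of q \<nu>] orth
      by (simp add: inner_graph_normal_lift3 left_diff_distrib diff_divide_distrib)
  qed
  ultimately have "(g0 * ?v) * ((m0 - m2) * (norm \<nu>)\<^sup>2 / ?v) \<le> G ?P * (\<nu> \<bullet> (D2p F ?P *v \<nu>))"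
    using v m GP by (intro mult_mono) auto
  then show "g0 * (m0 - m2) * (norm \<nu>)\<^sup>2 \<le> \<nu> \<bullet> (flow_matrix F G q *v \<nu>)"
    using v by (simp add: eq)
qed

section \<open>First and second order conditions at a maximum\<close>

definition double_dot :: "real^2^2 \<Rightarrow> real^2^2 \<Rightarrow> real" where
  "double_dot A M = (\<Sum>i\<in>UNIV. \<Sum>j\<in>UNIV. A $ i $ j * M $ i $ j)"

lemma double_dot_diff: "double_dot A (M - N) = double_dot A M - double_dot A N"
  by (simp add: double_dot_def sum_2 algebra_simps)

text \<open>The trace of the product of a positive and a negative semidefinite matrix is nonpositive. The
  pairing with the symmetric matrix \<open>M\<close> only sees the symmetric part of \<open>A\<close>.\<close>

lemma double_dot_nonpos:
  assumes psd: "\<And>\<nu>. 0 \<le> \<nu> \<bullet> (A *v \<nu>)" and nsd: "\<And>\<nu>. \<nu> \<bullet> (M *v \<nu>) \<le> 0"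
    and sym: "M $ 1 $ 2 = M $ 2 $ 1"
  shows "double_dot A M \<le> 0"
proof -
  define a b c where "a = A$1$1" "b = (A$1$2 + A$2$1) / 2" "c = A$2$2"
  define m n k where "m = M$1$1" "n = M$1$2" "k = M$2$2"
  have A: "0 \<le> a * x\<^sup>2 + 2 * b * x * y + c * y\<^sup>2" for x y
    using psd[of "vector [x, y]"]
    by (simp add: inner_matrix_sum sum_2 a_b_c_def algebra_simps power2_eq_square add_divide_distrib)
  have M: "m * x\<^sup>2 + 2 * n * x * y + k * y\<^sup>2 \<le> 0" for x y
    using nsd[of "vector [x, y]"] sym
    by (simp add: inner_matrix_sum sum_2 m_n_k_def algebra_simps power2_eq_square)
  have tr: "double_dot A M = a * m + 2 * b * n + c * k"
    using sym by (simp add: double_dot_def sum_2 a_b_c_def m_n_k_def algebra_simps add_divide_distrib)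
  have pos: "0 \<le> a" "0 \<le> c" "k \<le> 0" using A[of 1 0] A[of 0 1] M[of 0 1] by auto
  show ?thesis
  proof (cases "a = 0")
    case True
    have "b = 0"
    proof (rule ccontr)
      assume "b \<noteq> 0"
      \<comment> \<open>The form is affine in its first argument, so it takes negative values, here the value \<open>- 1\<close>.\<close>
      then show False using A[of "- (c + 1) / (2 * b)" 1] True by simp
    qed
    then show ?thesis using pos True by (simp add: tr mult_nonneg_nonpos)
  next
    case False
    then have "0 < a" using pos by simp
    have "a * (a * c - b\<^sup>2) = a * b\<^sup>2 + 2 * b * b * (-a) + c * (-a)\<^sup>2"
      by (simp add: power2_eq_square algebra_simps)
    then have "0 \<le> a * (a * c - b\<^sup>2)" using A[of b "-a"] by metis
    then have "0 \<le> a * c - b\<^sup>2"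
      using \<open>0 < a\<close> by (simp add: zero_le_mult_iff)
    then have "(a * c - b\<^sup>2) * k \<le> 0" using pos by (simp add: mult_nonneg_nonpos)
    moreover have "a * (a * m + 2 * b * n + c * k) = (m * a\<^sup>2 + 2 * n * a * b + k * b\<^sup>2) + (a * c - b\<^sup>2) * k"
      by (simp add: power2_eq_square algebra_simps)
    ultimately have "a * double_dot A M \<le> 0" using M[of a b] by (simp add: tr)
    then show ?thesis using \<open>0 < a\<close> by (simp add: mult_le_0_iff)
  qed
qed

lemma has_derivative_along_ray:
  fixes w :: "'a::real_normed_vector \<Rightarrow> real"
  assumes w: "(w has_derivative f') (at (x + u *\<^sub>R d) within S)"
    and R: "\<And>s. s \<in> R \<Longrightarrow> x + s *\<^sub>R d \<in> S"
  shows "((\<lambda>s. w (x + s *\<^sub>R d)) has_derivative (\<lambda>h. h * f' d)) (at u within R)"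
proof -
  have l: "((\<lambda>s. x + s *\<^sub>R d) has_derivative (\<lambda>h. h *\<^sub>R d)) (at u within R)"
    by (auto intro!: derivative_eq_intros)
  have "(w has_derivative f') (at (x + u *\<^sub>R d) within (\<lambda>s. x + s *\<^sub>R d) ` R)"
    using w by (rule has_derivative_subset) (use R in auto)
  from has_derivative_in_compose[OF l this]
  show ?thesis
    using linear_scale[OF has_derivative_linear[OF w]] by simp
qed

lemma eventually_ray_in_open:
  fixes x :: "'a::real_normed_vector"
  assumes "open U" "x \<in> U" shows "\<forall>\<^sub>F s in at_right 0. x + s *\<^sub>R d \<in> U"
proof -
  have "((\<lambda>s. x + s *\<^sub>R d) \<longlongrightarrow> x + 0 *\<^sub>R d) (at_right 0)" by (intro tendsto_intros)
  then show ?thesis using topological_tendstoD[OF _ assms(1)] assms(2) by fastforce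
qed

text \<open>Here and below the maximum may lie on the boundary of \<open>S\<close>; only rays that stay in \<open>S\<close> for a short
  time are used.\<close>

lemma first_derivative_at_max:
  fixes w :: "'a::real_normed_vector \<Rightarrow> real"
  assumes w: "(w has_derivative f') (at x within S)" and x: "x \<in> S"
    and max: "\<And>y. y \<in> S \<Longrightarrow> w y \<le> w x" and dir: "\<forall>\<^sub>F s in at_right 0. x + s *\<^sub>R d \<in> S"
  shows "f' d \<le> 0"
proof (rule ccontr)
  assume "\<not> f' d \<le> 0"
  obtain b where b: "b > 0" "\<And>s. 0 < s \<Longrightarrow> s < b \<Longrightarrow> x + s *\<^sub>R d \<in> S"
    using dir unfolding eventually_at_right_field by blast
  have "((\<lambda>s. w (x + s *\<^sub>R d)) has_derivative (\<lambda>h. h * f' d)) (at 0 within {0..<b})"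
    by (rule has_derivative_along_ray[where S = S]) (use w x b(2) in \<open>auto simp: le_less\<close>)
  then have "((\<lambda>s. w (x + s *\<^sub>R d)) has_real_derivative f' d) (at 0 within {0..<b})"
    unfolding has_field_derivative_def by (rule has_derivative_eq_rhs) (simp add: mult.commute fun_eq_iff)
  from has_real_derivative_pos_inc_right[OF this] \<open>\<not> f' d \<le> 0\<close>
  obtain m where m: "m > 0" "\<And>h. h > 0 \<Longrightarrow> h \<in> {0..<b} \<Longrightarrow> h < m \<Longrightarrow> w x < w (x + h *\<^sub>R d)" by auto
  show False
  proof -
    define h where "h = min m b / 2"
    have "0 < h" "h < m" "h < b" using m(1) b(1) by (auto simp: h_def)
    then have "w x < w (x + h *\<^sub>R d)" "w (x + h *\<^sub>R d) \<le> w x"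
      using m(2) max[OF b(2)] by auto
    then show False by simp
  qed
qed

lemma second_derivative_at_max:
  fixes w :: "real^2 \<Rightarrow> real"
  assumes w: "\<And>y. y \<in> S \<Longrightarrow> (w has_derivative (\<lambda>h. p y \<bullet> h)) (at y within S)"
    and p: "(p has_derivative (\<lambda>h. M *v h)) (at x within S)" and p0: "p x = 0" and x: "x \<in> S"
    and max: "\<And>y. y \<in> S \<Longrightarrow> w y \<le> w x" and dir: "\<forall>\<^sub>F s in at_right 0. x + s *\<^sub>R d \<in> S"
  shows "d \<bullet> (M *v d) \<le> 0"
proof (rule ccontr)
  assume neg: "\<not> d \<bullet> (M *v d) \<le> 0"
  define q where "q = d \<bullet> (M *v d)"
  have q: "q > 0" using neg by (simp add: q_def)
  then have d0: "d \<noteq> 0" by (auto simp: q_def)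
  \<comment> \<open>With this precision the linear approximation of the gradient retains half of its growth along \<open>d\<close>.\<close>
  define e where "e = q / (2 * (norm d)\<^sup>2)"
  have e: "e > 0" using q d0 by (simp add: e_def)
  obtain b where b: "b > 0" "\<And>s. 0 < s \<Longrightarrow> s < b \<Longrightarrow> x + s *\<^sub>R d \<in> S"
    using dir unfolding eventually_at_right_field by blast
  obtain r where r: "r > 0" "\<And>y. y \<in> S \<Longrightarrow> norm (y - x) < r \<Longrightarrow>
      norm (p y - p x - M *v (y - x)) \<le> e * norm (y - x)"
    using p e unfolding has_derivative_within_alt by blast
  have pos: "0 < p (x + u *\<^sub>R d) \<bullet> d" if u: "0 < u" "u < b" "u * norm d < r" for u
  proof -
    have "norm (p (x + u *\<^sub>R d) - u *\<^sub>R (M *v d)) \<le> e * (u * norm d)"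
      using r(2)[OF b(2)[OF u(1,2)]] u p0 by (simp add: matrix_vector_mult_scaleR)
    then have "\<bar>(p (x + u *\<^sub>R d) - u *\<^sub>R (M *v d)) \<bullet> d\<bar> \<le> e * (u * norm d) * norm d"
      by (intro order_trans[OF Cauchy_Schwarz_ineq2] mult_right_mono) auto
    moreover have "e * (u * norm d) * norm d = u * q / 2"
      using d0 by (simp add: e_def power2_eq_square)
    moreover have "(u *\<^sub>R (M *v d)) \<bullet> d = u * q" by (simp add: q_def inner_commute)
    moreover have "0 < u * q" using u q by simp
    ultimately show ?thesis unfolding inner_diff_left abs_le_iff by linarith
  qed
  define s where "s = min b (r / norm d) / 2"
  have s: "0 < s" "s < b" "s * norm d < r"
    using b(1) r(1) d0 by (auto simp: s_def min_def field_simps)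
  have inS: "x + u *\<^sub>R d \<in> S" if "u \<in> {0..s}" for u
    using b(2)[of u] that s x by (cases "u = 0") auto
  have "\<exists>u\<in>{0<..<s}. w (x + s *\<^sub>R d) - w (x + 0 *\<^sub>R d) = (s - 0) * (p (x + u *\<^sub>R d) \<bullet> d)"
  proof (rule mvt_simple[OF s(1)])
    fix u assume "0 \<le> u" "u \<le> s"
    then show "((\<lambda>s. w (x + s *\<^sub>R d)) has_derivative (\<lambda>h. h * (p (x + u *\<^sub>R d) \<bullet> d))) (at u within {0..s})"
      by (intro has_derivative_along_ray[where S = S] w inS) auto
  qed
  then obtain u where u: "0 < u" "u < s" "w (x + s *\<^sub>R d) - w x = s * (p (x + u *\<^sub>R d) \<bullet> d)" by auto
  have "u * norm d \<le> s * norm d" using u(2) by (intro mult_right_mono) auto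
  then have "u * norm d < r" using s(3) by linarith
  with pos[OF u(1)] u(2) s have "0 < s * (p (x + u *\<^sub>R d) \<bullet> d)" by simp
  with u(3) max[OF inS[of s]] s(1) show False by simp
qed

text \<open>At a critical maximum a half-plane of admissible directions suffices: the quadratic form is even, so
  it is nonpositive on the opposite half-plane as well, and on the separating line by continuity.\<close>

lemma double_dot_nonpos_at_max:
  fixes w :: "real^2 \<Rightarrow> real"
  assumes w: "\<And>y. y \<in> S \<Longrightarrow> (w has_derivative (\<lambda>h. p y \<bullet> h)) (at y within S)"
    and p: "(p has_derivative (\<lambda>h. M *v h)) (at x within S)" and p0: "p x = 0" and x: "x \<in> S"
    and max: "\<And>y. y \<in> S \<Longrightarrow> w y \<le> w x" and n: "n \<noteq> 0"
    and dir: "\<And>d. 0 < d \<bullet> n \<Longrightarrow> \<forall>\<^sub>F s in at_right 0. x + s *\<^sub>R d \<in> S"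
    and sym: "M $ 1 $ 2 = M $ 2 $ 1" and psd: "\<And>\<nu>. 0 \<le> \<nu> \<bullet> (A *v \<nu>)"
  shows "double_dot A M \<le> 0"
proof (rule double_dot_nonpos[OF psd _ sym])
  have pos: "d \<bullet> (M *v d) \<le> 0" if "0 < d \<bullet> n" for d
    using second_derivative_at_max[OF w p p0 x max dir[OF that]] .
  fix d :: "real^2"
  consider "0 < d \<bullet> n" | "0 < (- d) \<bullet> n" | "d \<bullet> n = 0" by (auto simp: inner_minus_left) linarith
  then show "d \<bullet> (M *v d) \<le> 0"
  proof cases
    case 2
    from pos[OF this] show ?thesis by (simp add: inner_matrix_sum sum_2)
  next
    case 3
    have "((\<lambda>e. (d + e *\<^sub>R n) \<bullet> (M *v (d + e *\<^sub>R n))) \<longlongrightarrow> (d + 0 *\<^sub>R n) \<bullet> (M *v (d + 0 *\<^sub>R n))) (at_right 0)"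
      unfolding matrix_vector_right_distrib matrix_vector_mult_scaleR by (intro tendsto_intros)
    moreover have "\<forall>\<^sub>F e in at_right 0. (d + e *\<^sub>R n) \<bullet> (M *v (d + e *\<^sub>R n)) \<le> 0"
    proof -
      have "(d + e *\<^sub>R n) \<bullet> (M *v (d + e *\<^sub>R n)) \<le> 0" if "0 < e" for e
        using n 3 that by (intro pos) (simp add: inner_add_left)
      then show ?thesis unfolding eventually_at_right_field by (intro exI[of _ 1]) auto
    qed
    ultimately have "(d + 0 *\<^sub>R n) \<bullet> (M *v (d + 0 *\<^sub>R n)) \<le> 0"
      by (rule tendsto_upperbound) simp
    then show ?thesis by simp
  qed (rule pos)
qed

lemma max_of_difference:
  fixes f g :: "real^2 \<Rightarrow> real"
  assumes f: "\<And>y. y \<in> S \<Longrightarrow> (f has_derivative (\<lambda>h. pf y \<bullet> h)) (at y within S)"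
      "(pf has_derivative (\<lambda>h. Mf *v h)) (at x within S)" "Mf $ 1 $ 2 = Mf $ 2 $ 1"
    and g: "\<And>y. y \<in> S \<Longrightarrow> (g has_derivative (\<lambda>h. pg y \<bullet> h)) (at y within S)"
      "(pg has_derivative (\<lambda>h. Mg *v h)) (at x within S)" "Mg $ 1 $ 2 = Mg $ 2 $ 1"
    and p: "pf x = pg x" and x: "x \<in> S"
    and max: "\<And>y. y \<in> S \<Longrightarrow> f y - g y \<le> f x - g x" and n: "n \<noteq> 0"
    and dir: "\<And>d. 0 < d \<bullet> n \<Longrightarrow> \<forall>\<^sub>F s in at_right 0. x + s *\<^sub>R d \<in> S"
    and psd: "\<And>\<nu>. 0 \<le> \<nu> \<bullet> (A *v \<nu>)"
  shows "double_dot A Mf \<le> double_dot A Mg"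
proof -
  have "double_dot A (Mf - Mg) \<le> 0"
  proof (rule double_dot_nonpos_at_max[where w = "\<lambda>y. f y - g y" and p = "\<lambda>y. pf y - pg y" and S = S])
    show "((\<lambda>y. f y - g y) has_derivative (\<lambda>h. (pf y - pg y) \<bullet> h)) (at y within S)" if "y \<in> S" for y
      using has_derivative_diff[OF f(1)[OF that] g(1)[OF that]] by (simp add: inner_diff_left)
    show "((\<lambda>y. pf y - pg y) has_derivative (\<lambda>h. (Mf - Mg) *v h)) (at x within S)"
      using has_derivative_diff[OF f(2) g(2)] by (simp add: matrix_vector_mult_diff_rdistrib)
  qed (use f(3) g(3) p x max n dir psd in auto)
  then show ?thesis by (simp add: double_dot_diff)
qed

lemma time_derivative_at_max:
  fixes f :: "real \<Rightarrow> real"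
  assumes "(f has_real_derivative D) (at t within {0..T})" "t \<in> {0<..T}"
    and max: "\<And>s. s \<in> {0..T} \<Longrightarrow> f s \<le> f t"
  shows "0 \<le> D"
proof (rule ccontr)
  assume "\<not> 0 \<le> D"
  then obtain m where m: "m > 0" "\<And>h. h > 0 \<Longrightarrow> t - h \<in> {0..T} \<Longrightarrow> h < m \<Longrightarrow> f t < f (t - h)"
    using has_real_derivative_neg_dec_left[OF assms(1)] by auto
  define h where "h = min m t / 2"
  have "h > 0" "t - h \<in> {0..T}" "h < m" using m(1) assms(2) by (auto simp: h_def min_def)
  with m(2) max[of "t - h"] show False by fastforce
qed

section \<open>The comparison principle\<close>

lemma unit_tangent_frame:
  assumes "norm (inward_normal \<Omega> x) = 1"
  shows unit_tangent_orthogonal: "unit_tangent \<Omega> x \<bullet> inward_normal \<Omega> x = 0"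
    and frame_decomposition: "q = (q \<bullet> inward_normal \<Omega> x) *\<^sub>R inward_normal \<Omega> x
      + (q \<bullet> unit_tangent \<Omega> x) *\<^sub>R unit_tangent \<Omega> x"
    and frame_norm: "(norm q)\<^sup>2 = (q \<bullet> inward_normal \<Omega> x)\<^sup>2 + (q \<bullet> unit_tangent \<Omega> x)\<^sup>2"
    and norm_unit_tangent: "norm (unit_tangent \<Omega> x) = 1"
proof -
  define a b where "a = inward_normal \<Omega> x $ 1" "b = inward_normal \<Omega> x $ 2"
  have T: "unit_tangent \<Omega> x = vector [b, - a]" by (simp add: unit_tangent_def a_b_def)
  have "(norm (inward_normal \<Omega> x))\<^sup>2 = a * a + b * b"
    unfolding power2_norm_eq_inner by (simp add: inner_vec_def sum_2 a_b_def)
  then have ab: "b * b = 1 - a * a" using assms by simp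
  show "unit_tangent \<Omega> x \<bullet> inward_normal \<Omega> x = 0"
    by (simp add: T inner_vec_def sum_2 a_b_def)
  have ab': "b * (b * z) = z - a * (a * z)" for z
    by (metis ab left_diff_distrib mult.assoc mult_1)
  show "q = (q \<bullet> inward_normal \<Omega> x) *\<^sub>R inward_normal \<Omega> x + (q \<bullet> unit_tangent \<Omega> x) *\<^sub>R unit_tangent \<Omega> x"
    by (simp add: vec_eq_iff forall_2 T inner_vec_def sum_2 flip: a_b_def) (simp add: algebra_simps ab')
  show "(norm q)\<^sup>2 = (q \<bullet> inward_normal \<Omega> x)\<^sup>2 + (q \<bullet> unit_tangent \<Omega> x)\<^sup>2"
    unfolding power2_norm_eq_inner
    by (simp add: T inner_vec_def sum_2 flip: a_b_def) (simp add: algebra_simps power2_eq_square ab')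
  have "(norm (unit_tangent \<Omega> x))\<^sup>2 = 1"
    unfolding power2_norm_eq_inner by (simp add: T inner_vec_def sum_2 ab)
  then show "norm (unit_tangent \<Omega> x) = 1"
    using power2_eq_imp_eq[of "norm (unit_tangent \<Omega> x)" 1] by simp
qed

lemma linear_nonpos_on_halfspace:
  fixes L :: "'a::real_inner \<Rightarrow> real"
  assumes L: "linear L" and nonpos: "\<And>d. 0 < d \<bullet> n \<Longrightarrow> L d \<le> 0" and n: "n \<noteq> 0" and \<tau>: "\<tau> \<bullet> n = 0"
  shows "L \<tau> = 0"
proof -
  have le: "L \<tau> \<le> 0" if \<tau>: "\<tau> \<bullet> n = 0" for \<tau>
  proof -
    have "((\<lambda>e. L \<tau> + e * L n) \<longlongrightarrow> L \<tau> + 0 * L n) (at_right 0)" by (intro tendsto_intros)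
    moreover have "\<forall>\<^sub>F e in at_right 0. L \<tau> + e * L n \<le> 0"
    proof -
      have "L \<tau> + e * L n \<le> 0" if "e > 0" for e
        using nonpos[of "\<tau> + e *\<^sub>R n"] \<tau> that n L by (simp add: inner_add_left linear_add linear_scale)
      then show ?thesis unfolding eventually_at_right_field by (intro exI[of _ 1]) auto
    qed
    ultimately have "L \<tau> + 0 * L n \<le> 0" by (rule tendsto_upperbound) simp
    then show ?thesis by simp
  qed
  show ?thesis using le[OF \<tau>] le[of "- \<tau>"] \<tau> L by (simp add: linear_neg)
qed

text \<open>The map \<open>a \<mapsto> a + c sqrt (1 + a\<^sup>2 + \<tau>\<^sup>2)\<close> is injective for \<open>\<bar>c\<bar> < 1\<close>, since the square root is
  1-Lipschitz in \<open>a\<close>.\<close>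

lemma contact_angle_injective:
  fixes a b \<tau> c :: real
  assumes "\<bar>c\<bar> < 1" "a = - sqrt (1 + (a\<^sup>2 + \<tau>\<^sup>2)) * c" "b = - sqrt (1 + (b\<^sup>2 + \<tau>\<^sup>2)) * c"
  shows "a = b"
proof (rule ccontr)
  assume ne: "a \<noteq> b"
  define r s where "r = sqrt (1 + (a\<^sup>2 + \<tau>\<^sup>2))" "s = sqrt (1 + (b\<^sup>2 + \<tau>\<^sup>2))"
  have rs: "r\<^sup>2 = 1 + (a\<^sup>2 + \<tau>\<^sup>2)" "s\<^sup>2 = 1 + (b\<^sup>2 + \<tau>\<^sup>2)" "r > 0" "s > 0"
    by (auto simp: r_s_def add_pos_nonneg)
  have "a\<^sup>2 < r\<^sup>2" "b\<^sup>2 < s\<^sup>2" unfolding rs(1,2) using zero_le_power2[of \<tau>] by linarith+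
  then have "\<bar>a\<bar> < r" "\<bar>b\<bar> < s"
    using rs(3,4) by (auto intro!: power2_less_imp_less[of "\<bar>a\<bar>"] power2_less_imp_less[of "\<bar>b\<bar>"])
  then have "\<bar>a + b\<bar> \<le> r + s" by linarith
  have "(r - s) * (r + s) = (a - b) * (a + b)"
    using rs(1,2) by (simp add: algebra_simps power2_eq_square)
  then have "\<bar>r - s\<bar> * (r + s) = \<bar>a - b\<bar> * \<bar>a + b\<bar>"
    using rs(3,4) by (metis abs_mult abs_of_pos add_pos_pos)
  also have "\<dots> \<le> \<bar>a - b\<bar> * (r + s)" using \<open>\<bar>a + b\<bar> \<le> r + s\<close> by (intro mult_left_mono) auto
  finally have "\<bar>r - s\<bar> \<le> \<bar>a - b\<bar>" using rs(3,4) by simp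
  have "a - b = - c * (r - s)" using assms(2,3) by (simp add: r_s_def algebra_simps)
  then have "\<bar>a - b\<bar> = \<bar>c\<bar> * \<bar>r - s\<bar>" by (simp add: abs_mult)
  also have "\<dots> \<le> \<bar>c\<bar> * \<bar>a - b\<bar>" using \<open>\<bar>r - s\<bar> \<le> \<bar>a - b\<bar>\<close> by (intro mult_left_mono) auto
  also have "\<dots> < 1 * \<bar>a - b\<bar>" using assms(1) ne by (intro mult_strict_right_mono) auto
  finally show False by simp
qed

text \<open>At a boundary maximum of \<open>f - g\<close> the tangential derivatives of \<open>f\<close> and \<open>g\<close> agree, and with the common
  tangential derivative the contact angle condition determines the normal derivative.\<close>

lemma contact_gradient_eq:
  assumes dom: "bounded_domain_of_class 3 \<Omega>" and x: "x \<in> frontier \<Omega>" and c: "\<bar>cos (\<theta> x)\<bar> < 1"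
    and f: "C_on 2 (closure \<Omega>) f" "contact_angle_condition \<Omega> \<theta> f"
    and g: "C_on 2 (closure \<Omega>) g" "contact_angle_condition \<Omega> \<theta> g"
    and max: "\<And>y. y \<in> closure \<Omega> \<Longrightarrow> f y - g y \<le> f x - g x"
  shows "grad (closure \<Omega>) f x = grad (closure \<Omega>) g x"
proof -
  let ?S = "closure \<Omega>" and ?N = "inward_normal \<Omega> x" and ?T = "unit_tangent \<Omega> x"
  let ?p = "grad ?S f x" and ?q = "grad ?S g x"
  have xS: "x \<in> ?S" using x by (simp add: frontier_def)
  have N: "norm ?N = 1" using norm_inward_normal[OF dom x] .
  have D: "((\<lambda>y. f y - g y) has_derivative (\<lambda>h. (?p - ?q) \<bullet> h)) (at x within ?S)"
    using has_derivative_diff[OF C_on_2_grad[OF f(1) xS] C_on_2_grad[OF g(1) xS]]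
    by (simp add: inner_diff_left)
  have nonpos: "(?p - ?q) \<bullet> d \<le> 0" if "0 < d \<bullet> ?N" for d
  proof (rule first_derivative_at_max[OF D xS])
    show "f y - g y \<le> f x - g x" if "y \<in> ?S" for y using max[OF that] .
    show "\<forall>\<^sub>F s in at_right 0. x + s *\<^sub>R d \<in> ?S"
      using inward_normal_inside[OF dom x that] closure_subset by (auto elim!: eventually_mono)
  qed
  have "?N \<noteq> 0" using N by auto
  moreover have "linear (\<lambda>h. (?p - ?q) \<bullet> h)"
    by (rule bounded_linear.linear[OF bounded_linear_inner_right])
  ultimately have "(?p - ?q) \<bullet> ?T = 0"
    by (intro linear_nonpos_on_halfspace[where L = "\<lambda>h. (?p - ?q) \<bullet> h" and n = ?N] nonpos
        unit_tangent_orthogonal[OF N])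
  then have T: "?p \<bullet> ?T = ?q \<bullet> ?T" by (simp add: inner_diff_left)
  have p: "?p \<bullet> ?N = - sqrt (1 + ((?p \<bullet> ?N)\<^sup>2 + (?q \<bullet> ?T)\<^sup>2)) * cos (\<theta> x)"
    using f(2) x unfolding contact_angle_condition_def T[symmetric] frame_norm[OF N, symmetric] by blast
  have q: "?q \<bullet> ?N = - sqrt (1 + ((?q \<bullet> ?N)\<^sup>2 + (?q \<bullet> ?T)\<^sup>2)) * cos (\<theta> x)"
    using g(2) x unfolding contact_angle_condition_def frame_norm[OF N, symmetric] by blast
  have "?p \<bullet> ?N = ?q \<bullet> ?N" by (rule contact_angle_injective[OF c p q])
  then show ?thesis using T frame_decomposition[OF N, of ?p] frame_decomposition[OF N, of ?q] by metis
qed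

text \<open>The regularity used in the comparison principle. The time derivative \<open>u'\<close> is a parameter, so that the
  notion applies to solutions, to their translates in time and to barriers in the same way.\<close>

definition regular_evolution ::
    "(real^2) set \<Rightarrow> real \<Rightarrow> (real^2 \<Rightarrow> real \<Rightarrow> real) \<Rightarrow> (real^2 \<Rightarrow> real \<Rightarrow> real) \<Rightarrow> bool" where
  "regular_evolution \<Omega> T u u' \<longleftrightarrow>
     continuous_on (closure \<Omega> \<times> {0..T}) (\<lambda>(x, t). u x t) \<and>
     (\<forall>t\<in>{0..T}. C_on 2 (closure \<Omega>) (\<lambda>x. u x t)) \<and>
     (\<forall>x\<in>closure \<Omega>. \<forall>t\<in>{0..T}. (u x has_real_derivative u' x t) (at t within {0..T}))"

abbreviation flow_operator ::
    "(real^2 \<Rightarrow> real^2^2) \<Rightarrow> (real^2) set \<Rightarrow> (real^2 \<Rightarrow> real \<Rightarrow> real) \<Rightarrow> real^2 \<Rightarrow> real \<Rightarrow> real" where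
  "flow_operator A \<Omega> u x t \<equiv>
     double_dot (A (Dx \<Omega> u x t)) (hess (closure \<Omega>) (\<lambda>y. u y t) x)"

text \<open>The function \<open>u - v - e t\<close> with small \<open>e > 0\<close> cannot have its maximum at a positive time: there the
  gradients of \<open>u\<close> and \<open>v\<close> agree, so both sides use the same coefficients \<open>A\<close>, and the Hessian
  inequality gives \<open>u' \<le> v'\<close>, whereas maximality in time gives \<open>u' \<ge> v' + e\<close>.\<close>

lemma comparison_principle:
  assumes dom: "bounded_domain_of_class 3 \<Omega>" and c: "\<And>x. x \<in> frontier \<Omega> \<Longrightarrow> \<bar>cos (\<theta> x)\<bar> < 1"
    and psd: "\<And>q \<nu>. 0 \<le> \<nu> \<bullet> (A q *v \<nu>)"
    and u: "regular_evolution \<Omega> T u u'"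
      "\<And>t. t \<in> {0..T} \<Longrightarrow> contact_angle_condition \<Omega> \<theta> (\<lambda>x. u x t)"
      "\<And>x t. x \<in> closure \<Omega> \<Longrightarrow> t \<in> {0..T} \<Longrightarrow> u' x t \<le> flow_operator A \<Omega> u x t"
    and v: "regular_evolution \<Omega> T v v'"
      "\<And>t. t \<in> {0..T} \<Longrightarrow> contact_angle_condition \<Omega> \<theta> (\<lambda>x. v x t)"
      "\<And>x t. x \<in> closure \<Omega> \<Longrightarrow> t \<in> {0..T} \<Longrightarrow> flow_operator A \<Omega> v x t \<le> v' x t"
    and init: "\<And>x. x \<in> closure \<Omega> \<Longrightarrow> u x 0 \<le> v x 0 + C"
    and x: "x \<in> closure \<Omega>" and t: "t \<in> {0..T}"
  shows "u x t \<le> v x t + C"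
proof -
  let ?S = "closure \<Omega>"
  have op: "open \<Omega>" and cpt: "compact ?S"
    using dom by (auto simp: bounded_domain_of_class_def)
  have le: "u x t - v x t - e * t \<le> C" if e: "e > 0" for e
  proof -
    let ?w = "\<lambda>z. u (fst z) (snd z) - v (fst z) (snd z) - e * snd z"
    have cont: "continuous_on (?S \<times> {0..T}) ?w"
      using u(1) v(1) unfolding regular_evolution_def case_prod_beta
      by (intro continuous_intros) auto
    have "compact (?S \<times> {0..T})" using cpt by (intro compact_Times) auto
    moreover have "?S \<times> {0..T} \<noteq> {}" using x t by blast
    ultimately obtain z where z: "z \<in> ?S \<times> {0..T}" "\<And>y. y \<in> ?S \<times> {0..T} \<Longrightarrow> ?w y \<le> ?w z"
      using continuous_attains_sup[OF _ _ cont] by blast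
    obtain x0 t0 where x0: "z = (x0, t0)" "x0 \<in> ?S" "t0 \<in> {0..T}" using z(1) by auto
    have max: "u y s - v y s - e * s \<le> u x0 t0 - v x0 t0 - e * t0" if "y \<in> ?S" "s \<in> {0..T}" for y s
      using z(2)[of "(y, s)"] that x0(1) by simp
    have "t0 = 0"
    proof (rule ccontr)
      assume "t0 \<noteq> 0"
      then have t0: "t0 \<in> {0<..T}" using x0 by auto
      have du: "(u x0 has_real_derivative u' x0 t0) (at t0 within {0..T})"
        and dv: "(v x0 has_real_derivative v' x0 t0) (at t0 within {0..T})"
        using u(1) v(1) x0 unfolding regular_evolution_def by blast+
      have "((\<lambda>t. u x0 t - v x0 t - e * t) has_real_derivative (u' x0 t0 - v' x0 t0 - e)) (at t0 within {0..T})"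
        using DERIV_diff[OF DERIV_diff[OF du dv] DERIV_cmult_Id[of e]] .
      from time_derivative_at_max[OF this t0] max[OF x0(2)]
      have 1: "0 \<le> u' x0 t0 - v' x0 t0 - e" by blast
      let ?f = "\<lambda>y. u y t0" and ?g = "\<lambda>y. v y t0"
      have C: "C_on 2 ?S ?f" "C_on 2 ?S ?g" using u(1) v(1) x0 by (auto simp: regular_evolution_def)
      have mx: "?f y - ?g y \<le> ?f x0 - ?g x0" if "y \<in> ?S" for y using max[OF that x0(3)] by simp
      \<comment> \<open>At an interior point every direction is admissible, so any half-plane will do.\<close>
      have "\<exists>n. n \<noteq> 0 \<and> (\<forall>d. 0 < d \<bullet> n \<longrightarrow> (\<forall>\<^sub>F s in at_right 0. x0 + s *\<^sub>R d \<in> ?S)) \<and>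
          grad ?S ?f x0 = grad ?S ?g x0"
      proof (cases "x0 \<in> \<Omega>")
        case True
        have in\<Omega>: "\<forall>\<^sub>F s in at_right 0. x0 + s *\<^sub>R d \<in> ?S" for d
          using eventually_ray_in_open[OF op True, of d] closure_subset
          by (auto elim!: eventually_mono)
        have D: "((\<lambda>y. ?f y - ?g y) has_derivative (\<lambda>h. (grad ?S ?f x0 - grad ?S ?g x0) \<bullet> h)) (at x0 within ?S)"
          using has_derivative_diff[OF C_on_2_grad[OF C(1) x0(2)] C_on_2_grad[OF C(2) x0(2)]]
          by (simp add: inner_diff_left)
        have "(grad ?S ?f x0 - grad ?S ?g x0) \<bullet> (grad ?S ?f x0 - grad ?S ?g x0) \<le> 0"
          by (rule first_derivative_at_max[OF D x0(2) mx in\<Omega>])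
        then have "grad ?S ?f x0 = grad ?S ?g x0"
          by (metis eq_iff_diff_eq_0 inner_eq_zero_iff inner_ge_zero order_antisym)
        then show ?thesis using in\<Omega> by (intro exI[of _ "axis 1 1"]) (auto simp: axis_eq_0_iff)
      next
        case False
        then have x0f: "x0 \<in> frontier \<Omega>" using x0(2) op by (simp add: frontier_def interior_open)
        have "\<forall>\<^sub>F s in at_right 0. x0 + s *\<^sub>R d \<in> ?S" if "0 < d \<bullet> inward_normal \<Omega> x0" for d
          using inward_normal_inside[OF dom x0f that] closure_subset by (auto elim!: eventually_mono)
        moreover have "grad ?S ?f x0 = grad ?S ?g x0"
          by (rule contact_gradient_eq[OF dom x0f c[OF x0f] C(1) u(2)[OF x0(3)] C(2) v(2)[OF x0(3)] mx])
        ultimately show ?thesis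
          using norm_inward_normal[OF dom x0f] by (intro exI[of _ "inward_normal \<Omega> x0"]) auto
      qed
      then obtain n where n: "n \<noteq> 0" "\<And>d. 0 < d \<bullet> n \<Longrightarrow> \<forall>\<^sub>F s in at_right 0. x0 + s *\<^sub>R d \<in> ?S"
        and gr: "grad ?S ?f x0 = grad ?S ?g x0" by blast
      have "double_dot (A (grad ?S ?f x0)) (hess ?S ?f x0) \<le> double_dot (A (grad ?S ?f x0)) (hess ?S ?g x0)"
        by (rule max_of_difference[OF C_on_2_grad[OF C(1)] C_on_2_hess[OF C(1) x0(2)] hess_symmetric[OF op C(1) x0(2)]
          C_on_2_grad[OF C(2)] C_on_2_hess[OF C(2) x0(2)] hess_symmetric[OF op C(2) x0(2)] gr x0(2) mx n(1) n(2) psd])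
      then have "flow_operator A \<Omega> u x0 t0 \<le> flow_operator A \<Omega> v x0 t0" using gr by simp
      with u(3)[OF x0(2,3)] v(3)[OF x0(2,3)] 1 e show False by linarith
    qed
    then show ?thesis using max[OF x t] init[OF x0(2)] by simp
  qed
  have "((\<lambda>e. u x t - v x t - e * t) \<longlongrightarrow> u x t - v x t - 0 * t) (at_right 0)" by (intro tendsto_intros)
  moreover have "\<forall>\<^sub>F e in at_right 0. u x t - v x t - e * t \<le> C"
    unfolding eventually_at_right_field using le by (intro exI[of _ 1]) auto
  ultimately have "u x t - v x t - 0 * t \<le> C"
    by (rule tendsto_upperbound) simp
  then show ?thesis by simp
qed

section \<open>The bound on the time derivative\<close>

text \<open>Relative derivatives at boundary points are chosen by Hilbert's operator. They agree for functions
  with the same set of derivatives, in particular for functions that differ by a constant or that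
  coincide on the set.\<close>

lemma frechet_derivative_add_const:
  "frechet_derivative (\<lambda>y. f y + c) F = frechet_derivative f F"
  for f :: "'a::real_normed_vector \<Rightarrow> 'b::real_normed_vector"
proof -
  have "((\<lambda>y. f y + c) has_derivative D) F \<longleftrightarrow> (f has_derivative D) F" for D
    using has_derivative_add[OF _ has_derivative_const[of c], of f D F]
      has_derivative_add[OF _ has_derivative_const[of "- c"], of "\<lambda>y. f y + c" D F]
    by auto
  then show ?thesis by (simp add: frechet_derivative_def)
qed

lemma pd_add_const: "pd S v (\<lambda>y. f y + c) = pd S v f"
  by (simp add: pd_def frechet_derivative_add_const fun_eq_iff)

lemma grad_add_const: "grad S (\<lambda>y. f y + c) = grad S f"
  by (simp add: grad_def pd_add_const fun_eq_iff)

lemma hess_add_const: "hess S (\<lambda>y. f y + c) = hess S f"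
  by (simp add: hess_def pd_add_const fun_eq_iff)

lemma C_on_2_add_const:
  assumes "C_on 2 S f" shows "C_on 2 S (\<lambda>y. f y + c)"
  using assms by (simp add: numeral_2_eq_2 pd_add_const differentiable_on_add)

lemma pd_cong:
  assumes "x \<in> S" "\<And>y. y \<in> S \<Longrightarrow> f y = g y"
  shows "pd S v f x = pd S v g x"
proof -
  have "(f has_derivative D) (at x within S) \<longleftrightarrow> (g has_derivative D) (at x within S)" for D
    using assms by (metis has_derivative_transform)
  then show ?thesis by (simp add: pd_def frechet_derivative_def)
qed

lemma grad_cong:
  assumes "x \<in> S" "\<And>y. y \<in> S \<Longrightarrow> f y = g y"
  shows "grad S f x = grad S g x"
  unfolding grad_def using pd_cong[OF assms] by simp

lemma hess_cong:
  assumes "x \<in> S" "\<And>y. y \<in> S \<Longrightarrow> f y = g y"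
  shows "hess S f x = hess S g x"
proof -
  have "pd S w (pd S v f) x = pd S w (pd S v g) x" for v w
    by (rule pd_cong[OF assms(1)]) (rule pd_cong[OF _ assms(2)])
  then show ?thesis by (simp add: hess_def)
qed

lemma derivative_bound_of_lipschitz:
  fixes f :: "real \<Rightarrow> real"
  assumes f: "(f has_real_derivative D) (at t within {0..T})" and t: "t \<in> {0..T}" "0 < T"
    and lip: "\<And>s. s \<in> {0..T} \<Longrightarrow> \<bar>f s - f t\<bar> \<le> K * \<bar>s - t\<bar>"
  shows "\<bar>D\<bar> \<le> K"
proof -
  have "t islimpt {0..T}" using t by (simp add: islimpt_Icc)
  then have nb: "at t within {0..T} \<noteq> bot" by (simp add: trivial_limit_within)
  have "((\<lambda>s. \<bar>(f s - f t) / (s - t)\<bar>) \<longlongrightarrow> \<bar>D\<bar>) (at t within {0..T})"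
    using f unfolding has_field_derivative_iff by (rule tendsto_rabs)
  moreover have "\<forall>\<^sub>F s in at t within {0..T}. \<bar>(f s - f t) / (s - t)\<bar> \<le> K"
    unfolding eventually_at_filter
    using lip by (intro always_eventually) (auto simp: divide_simps abs_divide)
  ultimately show ?thesis using nb by (rule tendsto_upperbound)
qed

lemma regular_evolution_affine_in_time:
  assumes "C_on 2 (closure \<Omega>) f"
  shows "regular_evolution \<Omega> T (\<lambda>x t. f x + k * t) (\<lambda>x t. k)"
  unfolding regular_evolution_def
proof (intro conjI ballI)
  have "continuous_on (closure \<Omega> \<times> {0..T}) (\<lambda>z. f (fst z) + k * snd z)"
    by (intro continuous_intros continuous_on_compose2[OF C_on_2_cont[OF assms]]) auto
  then show "continuous_on (closure \<Omega> \<times> {0..T}) (\<lambda>(x, t). f x + k * t)"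
    by (simp add: case_prod_beta)
  show "C_on 2 (closure \<Omega>) (\<lambda>x. f x + k * t)" for t
    by (rule C_on_2_add_const[OF assms])
  show "((\<lambda>t. f x + k * t) has_real_derivative k) (at t within {0..T})" for x t
    by (auto intro!: derivative_eq_intros)
qed

lemma regular_evolution_shift:
  assumes u: "regular_evolution \<Omega> T u u'" and h: "0 \<le> h"
  shows "regular_evolution \<Omega> (T - h) (\<lambda>x t. u x (h + t)) (\<lambda>x t. u' x (h + t))"
  unfolding regular_evolution_def
proof (intro conjI ballI)
  have c: "continuous_on (closure \<Omega> \<times> {0..T}) (\<lambda>z. u (fst z) (snd z))"
    using u by (simp add: regular_evolution_def case_prod_beta)
  have "continuous_on (closure \<Omega> \<times> {0..T - h}) (\<lambda>z. u (fst (fst z, h + snd z)) (snd (fst z, h + snd z)))"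
    by (rule continuous_on_compose2[OF c]) (use h in \<open>auto intro!: continuous_intros\<close>)
  then show "continuous_on (closure \<Omega> \<times> {0..T - h}) (\<lambda>(x, t). u x (h + t))"
    by (simp add: case_prod_beta)
  show "C_on 2 (closure \<Omega>) (\<lambda>x. u x (h + t))" if "t \<in> {0..T - h}" for t
    using u h that by (auto simp: regular_evolution_def)
  show "((\<lambda>t. u x (h + t)) has_real_derivative u' x (h + t)) (at t within {0..T - h})"
    if "x \<in> closure \<Omega>" "t \<in> {0..T - h}" for x t
  proof -
    have "(u x has_derivative (*) (u' x (h + t))) (at (h + t *\<^sub>R 1) within {0..T})"
      using u that h by (auto simp: regular_evolution_def has_field_derivative_def)
    from has_derivative_along_ray[OF this, of "{0..T - h}"] show ?thesis
      using h by (simp add: has_field_derivative_def mult_commute_abs)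
  qed
qed

text \<open>The functions \<open>u(x,0) \<plusminus> K t\<close> are barriers, whence \<open>\<bar>u(x,h) - u(x,0)\<bar> \<le> K h\<close>. The translate
  \<open>u(x,h+t)\<close> solves the same problem as \<open>u\<close>, so that this initial discrepancy does not grow in time.\<close>

lemma time_lipschitz:
  assumes dom: "bounded_domain_of_class 3 \<Omega>" and c: "\<And>x. x \<in> frontier \<Omega> \<Longrightarrow> \<bar>cos (\<theta> x)\<bar> < 1"
    and psd: "\<And>q \<nu>. 0 \<le> \<nu> \<bullet> (A q *v \<nu>)" and T: "0 < T"
    and u: "regular_evolution \<Omega> T u u'"
      "\<And>t. t \<in> {0..T} \<Longrightarrow> contact_angle_condition \<Omega> \<theta> (\<lambda>x. u x t)"
      "\<And>x t. x \<in> closure \<Omega> \<Longrightarrow> t \<in> {0..T} \<Longrightarrow> u' x t = flow_operator A \<Omega> u x t"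
    and K: "\<And>x. x \<in> closure \<Omega> \<Longrightarrow> \<bar>flow_operator A \<Omega> u x 0\<bar> \<le> K"
    and x: "x \<in> closure \<Omega>" and h: "0 \<le> h" "0 \<le> t" "h + t \<le> T"
  shows "\<bar>u x (h + t) - u x t\<bar> \<le> K * h"
proof -
  have C0: "C_on 2 (closure \<Omega>) (\<lambda>x. u x 0)" and b0: "contact_angle_condition \<Omega> \<theta> (\<lambda>x. u x 0)"
    using u(1) u(2)[of 0] T by (auto simp: regular_evolution_def)
  have b: "contact_angle_condition \<Omega> \<theta> (\<lambda>x. u x 0 + k * t)" for k t
    using b0 unfolding contact_angle_condition_def grad_add_const .
  have up: "u y h \<le> u y 0 + K * h" if y: "y \<in> closure \<Omega>" for y
  proof -
    have "u y h \<le> (u y 0 + K * h) + 0"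
    proof (rule comparison_principle[OF dom c psd u(1,2) _ regular_evolution_affine_in_time[OF C0] b])
      show "u' x t \<le> flow_operator A \<Omega> u x t" if "x \<in> closure \<Omega>" "t \<in> {0..T}" for x t
        using u(3)[OF that] by simp
      show "flow_operator A \<Omega> (\<lambda>x t. u x 0 + K * t) x t \<le> K" if "x \<in> closure \<Omega>" for x t
        using K[OF that] unfolding grad_add_const hess_add_const by linarith
    qed (use h y in auto)
    then show ?thesis by simp
  qed
  have lo: "u y 0 + (- K) * h \<le> u y h" if y: "y \<in> closure \<Omega>" for y
  proof -
    have "u y 0 + (- K) * h \<le> u y h + 0"
    proof (rule comparison_principle[OF dom c psd regular_evolution_affine_in_time[OF C0] b _ u(1,2)])
      show "flow_operator A \<Omega> u x t \<le> u' x t" if "x \<in> closure \<Omega>" "t \<in> {0..T}" for x t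
        using u(3)[OF that] by simp
      show "- K \<le> flow_operator A \<Omega> (\<lambda>x t. u x 0 + (- K) * t) x t" if "x \<in> closure \<Omega>" for x t
        using K[OF that] unfolding grad_add_const hess_add_const by linarith
    qed (use h y in auto)
    then show ?thesis by simp
  qed
  have ru: "regular_evolution \<Omega> (T - h) u u'"
    unfolding regular_evolution_def
  proof (intro conjI ballI)
    have sub: "{0..T - h} \<subseteq> {0..T}" using h by auto
    show "continuous_on (closure \<Omega> \<times> {0..T - h}) (\<lambda>(x, t). u x t)"
      using u(1) sub unfolding regular_evolution_def by (blast intro: continuous_on_subset)
    fix t assume t: "t \<in> {0..T - h}"
    then show "C_on 2 (closure \<Omega>) (\<lambda>x. u x t)"
      using u(1) sub unfolding regular_evolution_def by blast
    show "(u x has_real_derivative u' x t) (at t within {0..T - h})" if "x \<in> closure \<Omega>" for x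
      using u(1) sub t that DERIV_subset[OF _ sub] unfolding regular_evolution_def by blast
  qed
  note sh = regular_evolution_shift[OF u(1) h(1)]
  have shc: "contact_angle_condition \<Omega> \<theta> (\<lambda>x. u x (h + t))" if "t \<in> {0..T - h}" for t
    using u(2)[of "h + t"] that h by simp
  have she: "u' x (h + t) = flow_operator A \<Omega> (\<lambda>x t. u x (h + t)) x t"
    if "x \<in> closure \<Omega>" "t \<in> {0..T - h}" for x t
    using u(3)[of x "h + t"] that h by simp
  have "u x (h + t) \<le> u x t + K * h"
    by (rule comparison_principle[OF dom c psd sh shc _ ru u(2)])
       (use up x h she u(3) in auto)
  moreover have "u x t \<le> u x (h + t) + K * h"
    by (rule comparison_principle[OF dom c psd ru u(2) _ sh shc])
       (use lo x h she u(3) in \<open>auto simp: algebra_simps\<close>)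
  ultimately show ?thesis by linarith
qed

lemma time_derivative_bound:
  assumes "bounded_domain_of_class 3 \<Omega>" "\<And>x. x \<in> frontier \<Omega> \<Longrightarrow> \<bar>cos (\<theta> x)\<bar> < 1"
    and "\<And>q \<nu>. 0 \<le> \<nu> \<bullet> (A q *v \<nu>)" and T: "0 < T"
    and u: "regular_evolution \<Omega> T u u'"
      "\<And>t. t \<in> {0..T} \<Longrightarrow> contact_angle_condition \<Omega> \<theta> (\<lambda>x. u x t)"
      "\<And>x t. x \<in> closure \<Omega> \<Longrightarrow> t \<in> {0..T} \<Longrightarrow> u' x t = flow_operator A \<Omega> u x t"
    and K: "\<And>x. x \<in> closure \<Omega> \<Longrightarrow> \<bar>flow_operator A \<Omega> u x 0\<bar> \<le> K"
    and x: "x \<in> closure \<Omega>" and t: "t \<in> {0..T}"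
  shows "\<bar>u' x t\<bar> \<le> K"
proof (rule derivative_bound_of_lipschitz[OF _ t T])
  show "(u x has_real_derivative u' x t) (at t within {0..T})"
    using u(1) x t by (simp add: regular_evolution_def)
  note lip = time_lipschitz[OF assms(1-3) T u K x]
  show "\<bar>u x s - u x t\<bar> \<le> K * \<bar>s - t\<bar>" if "s \<in> {0..T}" for s
    using lip[of "s - t" t] lip[of "t - s" s] that t by (cases "t \<le> s") (auto simp: abs_minus_commute)
qed

section \<open>The gradient is maximal on the parabolic boundary\<close>

lemma has_derivative_translate:
  assumes "(w has_derivative f') (at (y + c) within S)" and "\<And>z. z \<in> B \<Longrightarrow> z + c \<in> S"
  shows "((\<lambda>z. w (z + c)) has_derivative f') (at y within B)"
proof -
  have l: "((\<lambda>z. z + c) has_derivative (\<lambda>h. h)) (at y within B)"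
    by (auto intro!: derivative_eq_intros)
  have "(w has_derivative f') (at (y + c) within (\<lambda>z. z + c) ` B)"
    using assms(1) by (rule has_derivative_subset) (use assms(2) in auto)
  from has_derivative_in_compose[OF l this] show ?thesis .
qed

lemma increment_le_gradient_bound:
  fixes w :: "'a::real_inner \<Rightarrow> real"
  assumes w: "\<And>r. r \<in> {0..h} \<Longrightarrow> (w has_derivative (\<lambda>z. p (y + r *\<^sub>R e) \<bullet> z)) (at (y + r *\<^sub>R e) within S)"
    and S: "\<And>r. r \<in> {0..h} \<Longrightarrow> y + r *\<^sub>R e \<in> S" and h: "0 < h" and e: "norm e = 1"
    and B: "\<And>r. r \<in> {0..h} \<Longrightarrow> norm (p (y + r *\<^sub>R e)) \<le> B"
  shows "w (y + h *\<^sub>R e) - w y \<le> h * B"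
proof -
  have "\<exists>r\<in>{0<..<h}. w (y + h *\<^sub>R e) - w (y + 0 *\<^sub>R e) = (h - 0) * (p (y + r *\<^sub>R e) \<bullet> e)"
  proof (rule mvt_simple[OF h])
    fix r assume "0 \<le> r" "r \<le> h"
    then show "((\<lambda>r. w (y + r *\<^sub>R e)) has_derivative (\<lambda>z. z * (p (y + r *\<^sub>R e) \<bullet> e))) (at r within {0..h})"
      by (intro has_derivative_along_ray[where S = S] w S) auto
  qed
  then obtain r where "0 < r" "r < h" and "w (y + h *\<^sub>R e) - w y = h * (p (y + r *\<^sub>R e) \<bullet> e)" by auto
  then have r: "r \<in> {0..h}" "w (y + h *\<^sub>R e) - w y = h * (p (y + r *\<^sub>R e) \<bullet> e)" by auto
  have "p (y + r *\<^sub>R e) \<bullet> e \<le> norm (p (y + r *\<^sub>R e)) * norm e" by (rule norm_cauchy_schwarz)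
  also have "\<dots> \<le> B" using B[OF r(1)] e by simp
  finally show ?thesis using r(2) h by simp
qed

lemma max_of_difference_interior:
  fixes f g :: "real^2 \<Rightarrow> real"
  assumes U: "open U" "x \<in> U"
    and f: "\<And>y. y \<in> U \<Longrightarrow> (f has_derivative (\<lambda>h. pf y \<bullet> h)) (at y within U)"
      "(pf has_derivative (\<lambda>h. Mf *v h)) (at x within U)" "Mf $ 1 $ 2 = Mf $ 2 $ 1"
    and g: "\<And>y. y \<in> U \<Longrightarrow> (g has_derivative (\<lambda>h. pg y \<bullet> h)) (at y within U)"
      "(pg has_derivative (\<lambda>h. Mg *v h)) (at x within U)" "Mg $ 1 $ 2 = Mg $ 2 $ 1"
    and max: "\<And>y. y \<in> U \<Longrightarrow> f y - g y \<le> f x - g x"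
  shows "pf x = pg x"
    and "(\<And>\<nu>. 0 \<le> \<nu> \<bullet> (A *v \<nu>)) \<Longrightarrow> double_dot A Mf \<le> double_dot A Mg"
proof -
  have D: "((\<lambda>y. f y - g y) has_derivative (\<lambda>h. (pf x - pg x) \<bullet> h)) (at x within U)"
    using has_derivative_diff[OF f(1)[OF U(2)] g(1)[OF U(2)]] by (simp add: inner_diff_left)
  have "(pf x - pg x) \<bullet> (pf x - pg x) \<le> 0"
    by (rule first_derivative_at_max[OF D U(2) max eventually_ray_in_open[OF U]])
  then show p: "pf x = pg x"
    by (metis eq_iff_diff_eq_0 inner_eq_zero_iff inner_ge_zero order_antisym)
  assume psd: "\<And>\<nu>. 0 \<le> \<nu> \<bullet> (A *v \<nu>)"
  have "axis 1 1 \<noteq> (0::real^2)" by (simp add: axis_eq_0_iff)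
  then show "double_dot A Mf \<le> double_dot A Mg"
    by (intro max_of_difference[OF f g p U(2) max _ eventually_ray_in_open[OF U] psd])
qed

text \<open>Fix a unit vector \<open>e\<close> and small \<open>h > 0\<close>, and let \<open>K\<close> be the set of points at distance at least \<open>\<delta> > h\<close> from
  the complement of the domain. On \<open>K\<close> the difference \<open>u(x + h e, t) - u(x, t)\<close> of two solutions is largest
  at the initial time or near the lateral boundary, where the mean value theorem and uniform continuity
  of \<open>Du\<close> bound it by \<open>h (M + \<eta>)\<close>. Dividing by \<open>h\<close> bounds every directional derivative, and for
  \<open>e = Du / \<bar>Du\<bar>\<close> this is the claim up to \<open>\<eta>\<close>.\<close>

lemma gradient_max_principle:
  assumes dom: "bounded_domain_of_class 3 \<Omega>" and psd: "\<And>q \<nu>. 0 \<le> \<nu> \<bullet> (A q *v \<nu>)"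
    and u: "regular_evolution \<Omega> T u u'"
      "\<And>x t. x \<in> closure \<Omega> \<Longrightarrow> t \<in> {0..T} \<Longrightarrow> u' x t = flow_operator A \<Omega> u x t"
    and cont: "continuous_on (closure \<Omega> \<times> {0..T}) (\<lambda>(x, t). Dx \<Omega> u x t)"
    and lateral: "\<And>x t. x \<in> frontier \<Omega> \<Longrightarrow> t \<in> {0..T} \<Longrightarrow> norm (Dx \<Omega> u x t) \<le> M"
    and initial: "\<And>x. x \<in> closure \<Omega> \<Longrightarrow> norm (Dx \<Omega> u x 0) \<le> M"
    and x: "x \<in> closure \<Omega>" and t: "t \<in> {0..T}"
  shows "norm (Dx \<Omega> u x t) \<le> M"
proof (cases "x \<in> \<Omega>")
  case False
  then have "x \<in> frontier \<Omega>" using x dom by (simp add: bounded_domain_of_class_def frontier_def interior_open)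
  then show ?thesis using lateral t by simp
next
  case x\<Omega>: True
  let ?S = "closure \<Omega>"
  have op: "open \<Omega>" and bdd: "bounded \<Omega>" and cpt: "compact ?S"
    using dom by (auto simp: bounded_domain_of_class_def)
  have M0: "0 \<le> M" using initial[OF x] norm_ge_zero order_trans by blast
  have C: "C_on 2 ?S (\<lambda>x. u x s)" if "s \<in> {0..T}" for s using u(1) that by (simp add: regular_evolution_def)
  show ?thesis
  proof (rule field_le_epsilon)
    fix \<eta> :: real assume \<eta>: "0 < \<eta>"
    show "norm (Dx \<Omega> u x t) \<le> M + \<eta>"
    proof (cases "Dx \<Omega> u x t = 0")
      case True then show ?thesis using M0 \<eta> by simp
    next
      case nz: False
      define e where "e = sgn (Dx \<Omega> u x t)"
      have e: "norm e = 1" using nz by (simp add: e_def norm_sgn)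
      have "uniformly_continuous_on (?S \<times> {0..T}) (\<lambda>(x, t). Dx \<Omega> u x t)"
        by (intro compact_uniformly_continuous cont compact_Times cpt) auto
      then obtain \<delta>1 where \<delta>1: "\<delta>1 > 0" "\<And>z z'. z \<in> ?S \<times> {0..T} \<Longrightarrow> z' \<in> ?S \<times> {0..T} \<Longrightarrow> dist z' z < \<delta>1 \<Longrightarrow>
          dist ((\<lambda>(x, t). Dx \<Omega> u x t) z') ((\<lambda>(x, t). Dx \<Omega> u x t) z) < \<eta>"
        unfolding uniformly_continuous_on_def using \<eta> by metis
      obtain r where r: "r > 0" "ball x r \<subseteq> \<Omega>" using op x\<Omega> open_contains_ball by blast
      \<comment> \<open>A point outside the interior of \<open>K\<close> is within \<open>2 \<delta>\<close> of the complement; the shift adds less than \<open>\<delta>\<close>.\<close>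
      define \<delta> where "\<delta> = min r (\<delta>1 / 3)"
      have \<delta>: "\<delta> > 0" "3 * \<delta> \<le> \<delta>1" "ball x \<delta> \<subseteq> \<Omega>"
        using r \<delta>1(1) by (auto simp: \<delta>_def)
      have near: "norm (Dx \<Omega> u y s) \<le> M + \<eta>"
        if y: "y \<in> \<Omega>" "z \<notin> \<Omega>" "dist y z < 3 * \<delta>" and s: "s \<in> {0..T}" for y z s
      proof -
        have "closed_segment y z \<inter> frontier \<Omega> \<noteq> {}"
          by (rule connected_Int_frontier) (use y in auto)
        then obtain f where f: "f \<in> closed_segment y z" "f \<in> frontier \<Omega>" by blast
        have "dist y f \<le> dist y z" using f(1) by (simp add: dist_in_closed_segment(1) dist_commute)
        then have "dist (f, s) (y, s) < \<delta>1" using y(3) \<delta>(2) by (simp add: dist_Pair_Pair dist_commute)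
        moreover have "f \<in> ?S" "y \<in> ?S" using f(2) y(1) closure_subset by (auto simp: frontier_def)
        ultimately have "dist (Dx \<Omega> u f s) (Dx \<Omega> u y s) < \<eta>"
          using \<delta>1(2)[of "(y, s)" "(f, s)"] s by simp
        then have "norm (Dx \<Omega> u y s) \<le> norm (Dx \<Omega> u f s) + \<eta>"
          using norm_triangle_ineq2[of "Dx \<Omega> u y s" "Dx \<Omega> u f s"]
          by (simp add: dist_norm norm_minus_commute)
        then show ?thesis using lateral[OF f(2) s] by simp
      qed
      define K where "K = {y. ball y \<delta> \<subseteq> \<Omega>}"
      have K\<Omega>: "K \<subseteq> \<Omega>" using \<delta>(1) by (auto simp: K_def)
      have xK: "x \<in> K" using \<delta>(3) by (simp add: K_def)
      have "open (- K)"
      proof -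
        have "- K = (\<Union>z\<in>- \<Omega>. ball z \<delta>)" by (auto simp: K_def dist_commute)
        then show ?thesis by auto
      qed
      then have "closed K" by (simp add: closed_def)
      moreover have "bounded K" using bdd K\<Omega> bounded_subset by blast
      ultimately have cK: "compact K" by (simp add: compact_eq_bounded_closed)
      have shift: "y + \<rho> *\<^sub>R e \<in> \<Omega>" if "y \<in> K" "\<rho> \<in> {0..h}" "h < \<delta>" for y \<rho> h
        using that e by (auto simp: K_def dist_norm intro!: subsetD[of "ball y \<delta>" \<Omega>])
      have key: "u (x + h *\<^sub>R e) t - u x t - \<epsilon> * t \<le> h * (M + \<eta>)" if h: "0 < h" "h < \<delta>" and \<epsilon>: "0 < \<epsilon>" for h \<epsilon>
      proof -
        let ?c = "h *\<^sub>R e"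
        let ?w = "\<lambda>z. u (fst z + ?c) (snd z) - u (fst z) (snd z) - \<epsilon> * snd z"
        have cu: "continuous_on (?S \<times> {0..T}) (\<lambda>z. u (fst z) (snd z))"
          using u(1) by (simp add: regular_evolution_def case_prod_beta)
        have hS: "y + ?c \<in> \<Omega>" "y + ?c \<in> ?S" "y \<in> ?S" if "y \<in> K" for y
          using shift[OF that, of h h] h closure_subset K\<Omega> that by auto
        have "continuous_on (K \<times> {0..T}) (\<lambda>z. u (fst (fst z + ?c, snd z)) (snd (fst z + ?c, snd z)))"
          by (rule continuous_on_compose2[OF cu]) (use hS in \<open>auto intro!: continuous_intros\<close>)
        moreover have "continuous_on (K \<times> {0..T}) (\<lambda>z. u (fst z) (snd z))"
          by (rule continuous_on_subset[OF cu]) (use hS in auto)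
        ultimately have cw: "continuous_on (K \<times> {0..T}) ?w" by (intro continuous_intros) auto
        have "compact (K \<times> {0..T})" using cK by (intro compact_Times) auto
        moreover have "K \<times> {0..T} \<noteq> {}" using xK t by blast
        ultimately obtain z where z: "z \<in> K \<times> {0..T}" "\<And>y. y \<in> K \<times> {0..T} \<Longrightarrow> ?w y \<le> ?w z"
          using continuous_attains_sup[OF _ _ cw] by blast
        obtain x0 t0 where x0: "z = (x0, t0)" "x0 \<in> K" "t0 \<in> {0..T}" using z(1) by auto
        have max: "u (y + ?c) s - u y s - \<epsilon> * s \<le> u (x0 + ?c) t0 - u x0 t0 - \<epsilon> * t0"
          if "y \<in> K" "s \<in> {0..T}" for y s
          using z(2)[of "(y, s)"] that x0(1) by simp
        have inc: "u (x0 + ?c) t0 - u x0 t0 \<le> h * (M + \<eta>)"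
          if "\<And>\<rho>. \<rho> \<in> {0..h} \<Longrightarrow> norm (Dx \<Omega> u (x0 + \<rho> *\<^sub>R e) t0) \<le> M + \<eta>"
        proof (rule increment_le_gradient_bound[where p = "\<lambda>y. Dx \<Omega> u y t0" and S = ?S, OF _ _ h(1) e])
          show "norm (Dx \<Omega> u (x0 + \<rho> *\<^sub>R e) t0) \<le> M + \<eta>" if "\<rho> \<in> {0..h}" for \<rho>
            using \<open>\<And>\<rho>. \<rho> \<in> {0..h} \<Longrightarrow> norm (Dx \<Omega> u (x0 + \<rho> *\<^sub>R e) t0) \<le> M + \<eta>\<close> that .
          show inS: "x0 + \<rho> *\<^sub>R e \<in> ?S" if "\<rho> \<in> {0..h}" for \<rho>
            using shift[OF x0(2) that h(2)] closure_subset by blast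
          show "((\<lambda>y. u y t0) has_derivative (\<lambda>z. Dx \<Omega> u (x0 + \<rho> *\<^sub>R e) t0 \<bullet> z)) (at (x0 + \<rho> *\<^sub>R e) within ?S)"
            if "\<rho> \<in> {0..h}" for \<rho>
            by (rule C_on_2_grad[OF C[OF x0(3)] inS[OF that]])
        qed
        have "u (x0 + ?c) t0 - u x0 t0 \<le> h * (M + \<eta>)"
        proof (cases "t0 = 0")
          case True
          show ?thesis
          proof (rule inc)
            fix \<rho> assume "\<rho> \<in> {0..h}"
            then have "x0 + \<rho> *\<^sub>R e \<in> ?S" using shift[OF x0(2) _ h(2)] closure_subset by blast
            then show "norm (Dx \<Omega> u (x0 + \<rho> *\<^sub>R e) t0) \<le> M + \<eta>"
              using initial True \<eta> by fastforce
          qed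
        next
          case False
          then have t0: "t0 \<in> {0<..T}" using x0(3) by auto
          show ?thesis
          proof (cases "x0 \<in> interior K")
            case True
            have inK: "y \<in> K" if "y \<in> interior K" for y using that interior_subset by blast
            let ?f = "\<lambda>y. u (y + ?c) t0" and ?g = "\<lambda>y. u y t0"
            let ?pf = "\<lambda>y. Dx \<Omega> u (y + ?c) t0" and ?pg = "\<lambda>y. Dx \<Omega> u y t0"
            let ?H = "\<lambda>y. hess ?S (\<lambda>y. u y t0) y"
            have f1: "(?f has_derivative (\<lambda>h. ?pf y \<bullet> h)) (at y within interior K)" if "y \<in> interior K" for y
              by (rule has_derivative_translate[OF C_on_2_grad[OF C[OF x0(3)]]]) (use inK that hS in auto)
            have f2: "(?pf has_derivative (\<lambda>h. ?H (x0 + ?c) *v h)) (at x0 within interior K)"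
              by (rule has_derivative_translate[OF C_on_2_hess[OF C[OF x0(3)]]]) (use inK True hS in auto)
            have g1: "(?g has_derivative (\<lambda>h. ?pg y \<bullet> h)) (at y within interior K)" if "y \<in> interior K" for y
              by (rule has_derivative_subset[OF C_on_2_grad[OF C[OF x0(3)]]]) (use inK that hS in auto)
            have g2: "(?pg has_derivative (\<lambda>h. ?H x0 *v h)) (at x0 within interior K)"
              by (rule has_derivative_subset[OF C_on_2_hess[OF C[OF x0(3)]]]) (use inK True hS in auto)
            note sym = hess_symmetric[OF op C[OF x0(3)]]
            have mx: "?f y - ?g y \<le> ?f x0 - ?g x0" if "y \<in> interior K" for y
              using max[OF inK[OF that] x0(3)] by simp
            have pe: "?pf x0 = ?pg x0"
              by (rule max_of_difference_interior(1)[OF open_interior True f1 f2 sym[OF hS(2)[OF x0(2)]]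
                  g1 g2 sym[OF hS(3)[OF x0(2)]] mx])
            have "double_dot (A (?pg x0)) (?H (x0 + ?c)) \<le> double_dot (A (?pg x0)) (?H x0)"
              by (rule max_of_difference_interior(2)[OF open_interior True f1 f2 sym[OF hS(2)[OF x0(2)]]
                  g1 g2 sym[OF hS(3)[OF x0(2)]] mx psd])
            then have "flow_operator A \<Omega> u (x0 + ?c) t0 \<le> flow_operator A \<Omega> u x0 t0"
              using pe by simp
            then have le: "u' (x0 + ?c) t0 \<le> u' x0 t0"
              using u(2) hS[OF x0(2)] x0(3) by simp
            have du: "(u (x0 + ?c) has_real_derivative u' (x0 + ?c) t0) (at t0 within {0..T})"
              and dv: "(u x0 has_real_derivative u' x0 t0) (at t0 within {0..T})"
              using u(1) hS[OF x0(2)] x0(3) unfolding regular_evolution_def by blast+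
            have "((\<lambda>t. u (x0 + ?c) t - u x0 t - \<epsilon> * t) has_real_derivative (u' (x0 + ?c) t0 - u' x0 t0 - \<epsilon>)) (at t0 within {0..T})"
              using DERIV_diff[OF DERIV_diff[OF du dv] DERIV_cmult_Id[of \<epsilon>]] .
            from time_derivative_at_max[OF this t0] max[OF x0(2)]
            have "0 \<le> u' (x0 + ?c) t0 - u' x0 t0 - \<epsilon>" by blast
            with le \<epsilon> show ?thesis by linarith
          next
            case notint: False
            have "\<not> ball x0 \<delta> \<subseteq> K" using notint \<delta>(1) by (auto simp: mem_interior)
            then obtain z' where z': "dist x0 z' < \<delta>" "z' \<notin> K" unfolding subset_iff mem_ball by blast
            from z'(2) obtain y where y: "dist z' y < \<delta>" "y \<notin> \<Omega>"
              unfolding K_def subset_iff mem_ball by blast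
            show ?thesis
            proof (rule inc)
              fix \<rho> assume \<rho>: "\<rho> \<in> {0..h}"
              have "dist (x0 + \<rho> *\<^sub>R e) x0 = \<rho>" using \<rho> e by (simp add: dist_norm)
              then have "dist (x0 + \<rho> *\<^sub>R e) y < 3 * \<delta>"
                using z'(1) y(1) \<rho> h dist_triangle[of "x0 + \<rho> *\<^sub>R e" y x0] dist_triangle[of x0 y z'] by simp
              then show "norm (Dx \<Omega> u (x0 + \<rho> *\<^sub>R e) t0) \<le> M + \<eta>"
                using near[OF shift[OF x0(2) \<rho> h(2)] y(2)] x0(3) by simp
            qed
          qed
        qed
        moreover have "0 \<le> \<epsilon> * t0" using \<epsilon> x0(3) by simp
        ultimately show ?thesis using max[OF xK t] by linarith
      qed
      have inc: "u (x + h *\<^sub>R e) t - u x t \<le> h * (M + \<eta>)" if h: "0 < h" "h < \<delta>" for h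
      proof -
        have "((\<lambda>\<epsilon>. u (x + h *\<^sub>R e) t - u x t - \<epsilon> * t) \<longlongrightarrow> u (x + h *\<^sub>R e) t - u x t - 0 * t) (at_right 0)"
          by (intro tendsto_intros)
        moreover have "\<forall>\<^sub>F \<epsilon> in at_right 0. u (x + h *\<^sub>R e) t - u x t - \<epsilon> * t \<le> h * (M + \<eta>)"
          unfolding eventually_at_right_field using key[OF h] by (intro exI[of _ 1]) auto
        ultimately have "u (x + h *\<^sub>R e) t - u x t - 0 * t \<le> h * (M + \<eta>)"
          by (rule tendsto_upperbound) simp
        then show ?thesis by simp
      qed
      have "Dx \<Omega> u x t \<bullet> e \<le> M + \<eta>"
      proof (rule ccontr)
        assume gt: "\<not> Dx \<Omega> u x t \<bullet> e \<le> M + \<eta>"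
        have "((\<lambda>y. u y t) has_derivative (\<lambda>z. Dx \<Omega> u x t \<bullet> z)) (at (x + 0 *\<^sub>R e) within ?S)"
          using C_on_2_grad[OF C[OF t] x] by simp
        from has_derivative_along_ray[OF this, of "{0..<\<delta>}"]
        have "((\<lambda>s. u (x + s *\<^sub>R e) t) has_derivative (\<lambda>h. h * (Dx \<Omega> u x t \<bullet> e))) (at 0 within {0..<\<delta>})"
          using shift[OF xK] closure_subset by fastforce
        then have "((\<lambda>s. u (x + s *\<^sub>R e) t) has_real_derivative (Dx \<Omega> u x t \<bullet> e)) (at 0 within {0..<\<delta>})"
          by (simp add: has_field_derivative_def mult_commute_abs)
        from has_real_derivative_pos_inc_right[OF DERIV_diff[OF this DERIV_cmult_Id[of "M + \<eta>"]]] gt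
        obtain m where m: "m > 0" "\<And>h. h > 0 \<Longrightarrow> h \<in> {0..<\<delta>} \<Longrightarrow> h < m \<Longrightarrow>
            u x t < u (x + h *\<^sub>R e) t - (M + \<eta>) * h"
          by auto
        define h where "h = min m \<delta> / 2"
        have "0 < h" "h < m" "h < \<delta>" using m(1) \<delta>(1) by (auto simp: h_def)
        with m(2)[of h] inc[of h] show False by (simp add: mult.commute)
      qed
      moreover have "Dx \<Omega> u x t \<bullet> e = norm (Dx \<Omega> u x t)"
        using nz by (simp add: e_def sgn_div_norm dot_square_norm power2_eq_square)
      ultimately show ?thesis by simp
    qed
  qed
qed

section \<open>The gradient at a boundary maximum\<close>

lemma double_dot_frame:
  fixes N T :: "real^2"
  assumes "T = vector [N $ 2, - N $ 1]" "norm N = 1"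
  shows "double_dot A H = (N \<bullet> (A *v N)) * (N \<bullet> (H *v N)) + (N \<bullet> (A *v T)) * (N \<bullet> (H *v T))
    + (T \<bullet> (A *v N)) * (T \<bullet> (H *v N)) + (T \<bullet> (A *v T)) * (T \<bullet> (H *v T))"
proof -
  define a b where "a = N $ 1" "b = N $ 2"
  have "(norm N)\<^sup>2 = a * a + b * b"
    unfolding power2_norm_eq_inner by (simp add: inner_vec_def sum_2 a_b_def)
  then have ab: "b * b = 1 - a * a" using assms(2) by simp
  have ab': "b * (b * z) = z - a * (a * z)" for z
    by (metis ab left_diff_distrib mult.assoc mult_1)
  show ?thesis
    unfolding assms(1)
    by (simp add: double_dot_def inner_vec_def matrix_vector_mult_def sum_2 flip: a_b_def)
       (simp add: algebra_simps ab ab')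
qed

text \<open>The derivative of \<open>N\<close> is tangential because \<open>\<bar>N\<bar> = 1\<close>; its tangential component is minus the
  curvature by definition.\<close>

lemma normal_derivative_frenet:
  assumes dom: "bounded_domain_of_class 3 \<Omega>" and x: "x \<in> frontier \<Omega>"
  shows "tangential_deriv \<Omega> (inward_normal \<Omega>) x = - curvature \<Omega> x *\<^sub>R unit_tangent \<Omega> x"
proof -
  let ?N = "inward_normal \<Omega>" and ?T = "unit_tangent \<Omega> x"
  let ?D = "frechet_derivative ?N (at x within frontier \<Omega>)"
  have N: "norm (?N x) = 1" using norm_inward_normal[OF dom x] .
  have D: "(?N has_derivative ?D) (at x within frontier \<Omega>)"
    using inward_normal_differentiable[OF dom x] frechet_derivative_works by blast
  have "((\<lambda>y. ?N y \<bullet> ?N y - 1) has_derivative (\<lambda>z. ?N x \<bullet> ?D z + ?D z \<bullet> ?N x - 0)) (at x within frontier \<Omega>)"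
    by (intro has_derivative_diff has_derivative_inner D has_derivative_const)
  from derivative_along_tangent_zero[OF dom x unit_tangent_orthogonal[OF N] this]
  have "?N x \<bullet> ?D ?T + ?D ?T \<bullet> ?N x - 0 = 0"
    using norm_inward_normal[OF dom] by (simp add: dot_square_norm)
  then have "?D ?T \<bullet> ?N x = 0" by (simp add: inner_commute)
  with frame_decomposition[OF N, of "?D ?T"] show ?thesis
    by (simp add: tangential_deriv_def curvature_def)
qed

text \<open>Differentiate \<open>Df \<bullet> N + sqrt (1 + \<bar>Df\<bar>\<^sup>2) cos \<theta> = 0\<close> along the tangent. The derivative of the square
  root vanishes by the hypothesis that \<open>\<bar>Df\<bar>\<close> is stationary in the tangential direction.\<close>

lemma contact_angle_tangential_derivative:
  assumes dom: "bounded_domain_of_class 3 \<Omega>" and x: "x \<in> frontier \<Omega>"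
    and f: "C_on 2 (closure \<Omega>) f" "contact_angle_condition \<Omega> \<theta> f"
    and \<theta>: "C_on_boundary 3 \<Omega> \<theta>"
    and crit: "p \<bullet> (H *v unit_tangent \<Omega> x) = 0"
    and p: "p = grad (closure \<Omega>) f x" and H: "H = hess (closure \<Omega>) f x"
  shows "inward_normal \<Omega> x \<bullet> (H *v unit_tangent \<Omega> x)
    = curvature \<Omega> x * (p \<bullet> unit_tangent \<Omega> x)
      + sqrt (1 + (norm p)\<^sup>2) * sin (\<theta> x) * tangential_deriv \<Omega> \<theta> x"
proof -
  let ?S = "closure \<Omega>" and ?F = "frontier \<Omega>" and ?N = "inward_normal \<Omega>" and ?T = "unit_tangent \<Omega> x"
  let ?DN = "frechet_derivative ?N (at x within ?F)" and ?D\<theta> = "frechet_derivative \<theta> (at x within ?F)"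
  let ?g = "grad ?S f"
  have N: "norm (?N x) = 1" using norm_inward_normal[OF dom x] .
  have DN: "(?N has_derivative ?DN) (at x within ?F)"
    using inward_normal_differentiable[OF dom x] frechet_derivative_works by blast
  have D\<theta>: "(\<theta> has_derivative ?D\<theta>) (at x within ?F)"
  proof -
    obtain U g where g: "open U" "?F \<subseteq> U" "C_on 3 U g" "\<forall>x\<in>?F. g x = \<theta> x"
      using \<theta> unfolding C_on_boundary_def by blast
    have "g differentiable_on U" using g(3) by (simp add: numeral_3_eq_3)
    then have "g differentiable (at x within ?F)"
      using g(2) x differentiable_on_subset differentiable_on_def by blast
    then obtain D where "(g has_derivative D) (at x within ?F)" by (auto simp: differentiable_def)
    then have "(\<theta> has_derivative D) (at x within ?F)"
      using has_derivative_transform[OF x, of \<theta> g] g(4) by auto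
    then show ?thesis using differentiableI frechet_derivative_works by blast
  qed
  have xS: "x \<in> ?S" using x by (simp add: frontier_def)
  have Dg: "(?g has_derivative (\<lambda>z. H *v z)) (at x within ?F)"
    using has_derivative_subset[OF C_on_2_hess[OF f(1) xS]] unfolding H by (simp add: frontier_def)
  define v where "v = sqrt (1 + p \<bullet> p)"
  have v: "1 + p \<bullet> p > 0" "v > 0" by (simp_all add: v_def add_pos_nonneg)
  have Dq: "((\<lambda>y. 1 + ?g y \<bullet> ?g y) has_derivative (\<lambda>z. 0 + (?g x \<bullet> (H *v z) + (H *v z) \<bullet> ?g x))) (at x within ?F)"
    by (intro has_derivative_add has_derivative_const has_derivative_inner Dg)
  have Dv: "((\<lambda>y. sqrt (1 + ?g y \<bullet> ?g y)) has_derivative (\<lambda>z. (p \<bullet> (H *v z)) / v)) (at x within ?F)"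
    by (rule has_derivative_eq_rhs[OF has_derivative_real_sqrt[OF _ Dq]])
       (use v in \<open>simp_all add: p[symmetric] v_def fun_eq_iff inner_commute field_simps\<close>)
  have Dc: "((\<lambda>y. cos (\<theta> y)) has_derivative (\<lambda>z. - sin (\<theta> x) * ?D\<theta> z)) (at x within ?F)"
    by (rule has_derivative_eq_rhs[OF has_derivative_cos[OF D\<theta>]]) (simp add: fun_eq_iff)
  have "((\<lambda>y. ?g y \<bullet> ?N y + sqrt (1 + ?g y \<bullet> ?g y) * cos (\<theta> y)) has_derivative
      (\<lambda>z. (?g x \<bullet> ?DN z + (H *v z) \<bullet> ?N x)
         + (sqrt (1 + ?g x \<bullet> ?g x) * (- sin (\<theta> x) * ?D\<theta> z) + (p \<bullet> (H *v z)) / v * cos (\<theta> x)))) (at x within ?F)"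
    by (intro has_derivative_add has_derivative_mult has_derivative_inner Dg DN Dv Dc)
  from derivative_along_tangent_zero[OF dom x unit_tangent_orthogonal[OF N] this]
  have "(?g x \<bullet> ?DN ?T + (H *v ?T) \<bullet> ?N x)
         + (sqrt (1 + ?g x \<bullet> ?g x) * (- sin (\<theta> x) * ?D\<theta> ?T) + (p \<bullet> (H *v ?T)) / v * cos (\<theta> x)) = 0"
    using f(2) by (simp add: contact_angle_condition_def power2_norm_eq_inner)
  moreover have "?DN ?T = - curvature \<Omega> x *\<^sub>R ?T"
    using normal_derivative_frenet[OF dom x] by (simp add: tangential_deriv_def)
  ultimately show ?thesis
    using crit by (simp add: p[symmetric] tangential_deriv_def power2_norm_eq_inner inner_commute)
qed

text \<open>With \<open>\<beta> = H\<^sub>N\<^sub>T / p\<^sub>T\<close>, stationarity \<open>p \<bullet> H T = 0\<close> expresses \<open>H\<^sub>T\<^sub>T\<close>, and \<open>p \<bullet> H N \<le> 0\<close> controls \<open>H\<^sub>N\<^sub>N\<close>, so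
  that \<open>p\<^sub>N H\<close> equals \<open>- \<beta> \<nu> \<otimes> \<nu>\<close> plus a nonpositive multiple of \<open>N \<otimes> N\<close>. Multiplying by \<open>p\<^sub>N\<close> instead of
  dividing by it keeps the argument uniform near \<open>\<theta> = \<pi> / 2\<close>. The two summands of the bound correspond
  to large and to bounded tangential derivative.\<close>

lemma boundary_gradient_bound:
  assumes dom: "bounded_domain_of_class 3 \<Omega>" and x: "x \<in> frontier \<Omega>"
    and f: "C_on 2 (closure \<Omega>) f" "contact_angle_condition \<Omega> \<theta> f"
    and max: "\<And>y. y \<in> closure \<Omega> \<Longrightarrow> norm (grad (closure \<Omega>) f y) \<le> norm (grad (closure \<Omega>) f x)"
    and \<theta>: "C_on_boundary 3 \<Omega> \<theta>" "\<bar>tangential_deriv \<Omega> \<theta> x\<bar> \<le> curvature \<Omega> x - \<delta>0"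
      "s0 \<le> sin (\<theta> x)" "0 < s0"
    and k: "curvature \<Omega> x \<le> k1" "0 < \<delta>0"
    and A: "\<And>\<nu>. 0 \<le> \<nu> \<bullet> (A *v \<nu>)" "0 < a0"
      "\<And>\<nu>. grad (closure \<Omega>) f x \<bullet> \<nu> = 0 \<Longrightarrow> a0 * (norm \<nu>)\<^sup>2 \<le> \<nu> \<bullet> (A *v \<nu>)"
    and K: "\<bar>double_dot A (hess (closure \<Omega>) f x)\<bar> \<le> K"
  shows "norm (grad (closure \<Omega>) f x) \<le> 2 * K / (\<delta>0 * a0) + sqrt (1 + k1 / \<delta>0) / s0"
proof -
  let ?S = "closure \<Omega>"
  define N T p H where "N = inward_normal \<Omega> x" "T = unit_tangent \<Omega> x" "p = grad ?S f x" "H = hess ?S f x"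
  note defs = this
  have op: "open \<Omega>" using dom by (simp add: bounded_domain_of_class_def)
  have xS: "x \<in> ?S" using x by (simp add: frontier_def)
  have N: "norm N = 1" using norm_inward_normal[OF dom x] by (simp add: defs)
  have TN: "T \<bullet> N = 0" unfolding defs by (rule unit_tangent_orthogonal) (use N defs in simp)
  define pN pT where "pN = p \<bullet> N" "pT = p \<bullet> T"
  have pdec: "p = pN *\<^sub>R N + pT *\<^sub>R T"
    unfolding pN_pT_def defs(1,2) by (rule frame_decomposition) (use N defs in simp)
  have pnorm: "(norm p)\<^sup>2 = pN\<^sup>2 + pT\<^sup>2"
    unfolding pN_pT_def defs(1,2) by (rule frame_norm) (use N defs in simp)
  have Tn: "norm T = 1" unfolding defs by (rule norm_unit_tangent) (use N defs in simp)
  have NN: "N \<bullet> N = 1" "T \<bullet> T = 1" "N \<bullet> T = 0"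
    using N Tn TN by (simp_all add: dot_square_norm inner_commute)
  have Hsym: "z \<bullet> (H *v w) = w \<bullet> (H *v z)" for z w
    using hess_symmetric[OF op f(1) xS, of 1 2]
    by (simp add: inner_vec_def matrix_vector_mult_def sum_2 defs algebra_simps)
  have K0: "0 \<le> K" using K by linarith
  have crit: "p \<bullet> (H *v T) = 0" and Y: "p \<bullet> (H *v N) \<le> 0"
  proof -
    have "((\<lambda>y. grad ?S f y \<bullet> grad ?S f y) has_derivative (\<lambda>z. p \<bullet> (H *v z) + (H *v z) \<bullet> p)) (at x within ?S)"
      unfolding defs(3,4) by (intro has_derivative_inner C_on_2_hess[OF f(1) xS])
    then have D: "((\<lambda>y. grad ?S f y \<bullet> grad ?S f y) has_derivative (\<lambda>z. 2 * (p \<bullet> (H *v z)))) (at x within ?S)"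
      by (rule has_derivative_eq_rhs) (simp add: fun_eq_iff inner_commute)
    have nonpos: "2 * (p \<bullet> (H *v d)) \<le> 0" if "0 < d \<bullet> N" for d
    proof (rule first_derivative_at_max[OF D xS])
      show "grad ?S f y \<bullet> grad ?S f y \<le> grad ?S f x \<bullet> grad ?S f x" if "y \<in> ?S" for y
        using max[OF that] by (simp add: norm_eq_sqrt_inner)
      show "\<forall>\<^sub>F s in at_right 0. x + s *\<^sub>R d \<in> ?S"
        using inward_normal_inside[OF dom x, of d] that closure_subset
        by (auto simp: defs elim!: eventually_mono)
    qed
    have "linear (\<lambda>d. 2 * (p \<bullet> (H *v d)))"
      by (rule has_derivative_linear[OF D])
    moreover have "N \<noteq> 0" using N by auto
    ultimately have "2 * (p \<bullet> (H *v T)) = 0"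
      by (intro linear_nonpos_on_halfspace[where L = "\<lambda>d. 2 * (p \<bullet> (H *v d))" and n = N] nonpos TN)
    then show "p \<bullet> (H *v T) = 0" by simp
    show "p \<bullet> (H *v N) \<le> 0" using nonpos[of N] NN by simp
  qed
  define a b c where "a = N \<bullet> (H *v N)" "b = N \<bullet> (H *v T)" "c = T \<bullet> (H *v T)"
  have b': "T \<bullet> (H *v N) = b" using Hsym[of T N] by (simp add: a_b_c_def)
  have e1: "pN * b + pT * c = 0"
    using crit by (simp add: pdec[symmetric] a_b_c_def) (simp add: pdec inner_add_left)
  have e2: "p \<bullet> (H *v N) = pN * a + pT * b"
    unfolding a_b_c_def(1) b'[symmetric] by (subst pdec) (simp add: inner_add_left)
  define v where "v = sqrt (1 + (norm p)\<^sup>2)"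
  have v: "v\<^sup>2 = 1 + (norm p)\<^sup>2" "0 < v" by (auto simp: v_def add_pos_nonneg)
  have bd: "b = curvature \<Omega> x * pT + v * sin (\<theta> x) * tangential_deriv \<Omega> \<theta> x"
    using contact_angle_tangential_derivative[OF dom x f \<theta>(1) crit[unfolded defs(2)] defs(3,4)]
    by (simp add: a_b_c_def pN_pT_def v_def defs(1,2))
  have pNv: "pN = - v * cos (\<theta> x)"
    using f(2) x by (auto simp: contact_angle_condition_def pN_pT_def v_def defs)
  have vs: "(v * sin (\<theta> x))\<^sup>2 = 1 + pT\<^sup>2"
  proof -
    have "(v * sin (\<theta> x))\<^sup>2 = v\<^sup>2 * (1 - (cos (\<theta> x))\<^sup>2)" by (simp add: sin_squared_eq power_mult_distrib)
    also have "\<dots> = v\<^sup>2 - pN\<^sup>2" by (simp add: pNv algebra_simps power_mult_distrib)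
    finally show ?thesis by (simp add: v(1) pnorm)
  qed
  have t1: "0 \<le> 2 * K / (\<delta>0 * a0)" using K0 k A by simp
  have k1: "0 \<le> k1" using \<theta>(2) k by linarith
  have t2: "0 \<le> sqrt (1 + k1 / \<delta>0) / s0" using \<theta>(4) k k1 by simp
  show ?thesis
  proof (cases "pT\<^sup>2 \<le> k1 / \<delta>0")
    case True
    have "norm p \<le> v"
      by (rule power2_le_imp_le) (use v in auto)
    have "(v * s0)\<^sup>2 \<le> (v * sin (\<theta> x))\<^sup>2"
      using \<theta>(3,4) v(2) by (intro power_mono mult_left_mono) auto
    also have "\<dots> \<le> 1 + k1 / \<delta>0" using vs True by simp
    finally have "v * s0 \<le> sqrt (1 + k1 / \<delta>0)" by (rule real_le_rsqrt)
    then have "v \<le> sqrt (1 + k1 / \<delta>0) / s0" using \<theta>(4) by (simp add: pos_le_divide_eq)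
    then show ?thesis using \<open>norm p \<le> v\<close> t1 by (simp add: defs)
  next
    case False
    have pT: "k1 < \<delta>0 * pT\<^sup>2" using False k(2) by (simp add: pos_divide_less_eq not_le mult.commute)
    then have "0 < \<delta>0 * pT\<^sup>2" using k1 by linarith
    then have pT0: "0 < pT\<^sup>2" using k(2) by (simp add: zero_less_mult_iff)
    have beta: "\<delta>0 / 2 * pT\<^sup>2 \<le> pT * b"
    proof -
      let ?\<kappa> = "curvature \<Omega> x" and ?r = "v * sin (\<theta> x)" and ?w = "tangential_deriv \<Omega> \<theta> x"
      \<comment> \<open>From \<open>?r\<^sup>2 = 1 + pT\<^sup>2\<close> and the arithmetic-geometric mean inequality.\<close>
      have r: "\<bar>pT * ?r\<bar> \<le> pT\<^sup>2 + 1 / 2"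
        using sum_squares_bound[of "\<bar>pT\<bar>" "\<bar>?r\<bar>"]
        unfolding power2_abs vs abs_mult[of pT ?r] mult.assoc by linarith
      have "\<bar>pT * ?r * ?w\<bar> \<le> (pT\<^sup>2 + 1 / 2) * (?\<kappa> - \<delta>0)"
        unfolding abs_mult[of "pT * ?r"] using r \<theta>(2) by (intro mult_mono) auto
      moreover have "pT * b = ?\<kappa> * pT\<^sup>2 + pT * ?r * ?w"
        by (simp add: bd algebra_simps power2_eq_square)
      ultimately have "?\<kappa> * pT\<^sup>2 - (pT\<^sup>2 + 1 / 2) * (?\<kappa> - \<delta>0) \<le> pT * b" by linarith
      then have "\<delta>0 * pT\<^sup>2 - (?\<kappa> - \<delta>0) / 2 \<le> pT * b" by (simp add: algebra_simps)
      moreover have "\<delta>0 / 2 * pT\<^sup>2 = (\<delta>0 * pT\<^sup>2) / 2" by simp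
      ultimately show ?thesis using k pT by argo
    qed
    define ANN where "ANN = N \<bullet> (A *v N)"
    define \<nu> where "\<nu> = pT *\<^sub>R N - pN *\<^sub>R T"
    have A\<nu>: "\<nu> \<bullet> (A *v \<nu>) = pT\<^sup>2 * ANN - pN * pT * (N \<bullet> (A *v T) + T \<bullet> (A *v N)) + pN\<^sup>2 * (T \<bullet> (A *v T))"
      by (simp add: \<nu>_def ANN_def matrix_vector_mult_diff_distrib matrix_vector_mult_scaleR inner_diff_left
          inner_diff_right algebra_simps power2_eq_square)
    have "p \<bullet> \<nu> = 0" by (simp add: \<nu>_def inner_diff_right pN_pT_def)
    then have low: "a0 * (norm \<nu>)\<^sup>2 \<le> \<nu> \<bullet> (A *v \<nu>)" using A(3) by (simp add: defs)
    have "(norm \<nu>)\<^sup>2 = pN\<^sup>2 + pT\<^sup>2"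
      unfolding power2_norm_eq_inner
      by (simp add: \<nu>_def inner_diff_left inner_diff_right NN TN power2_eq_square)
    with low pnorm have low: "a0 * (norm p)\<^sup>2 \<le> \<nu> \<bullet> (A *v \<nu>)" by simp
    have Tvec: "T = vector [N $ 2, - N $ 1]" by (simp add: defs unit_tangent_def)
    define dd where "dd = double_dot A H"
    have dd: "dd = ANN * a + (N \<bullet> (A *v T) + T \<bullet> (A *v N)) * b + (T \<bullet> (A *v T)) * c"
      unfolding dd_def double_dot_frame[OF Tvec N] b' a_b_c_def[symmetric] ANN_def[symmetric]
      by (simp add: algebra_simps)
    \<comment> \<open>The last summand, which vanishes by stationarity, is added to make this a polynomial identity.\<close>
    have "pT * (pN * dd) = pT * ANN * (p \<bullet> (H *v N)) - b * (\<nu> \<bullet> (A *v \<nu>)) + pN * (T \<bullet> (A *v T)) * (pN * b + pT * c)"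
      unfolding dd A\<nu> e2 by (simp add: algebra_simps power2_eq_square)
    then have "pT * (pT * (pN * dd)) = pT * (pT * ANN * (p \<bullet> (H *v N)) - b * (\<nu> \<bullet> (A *v \<nu>)))"
      by (simp add: e1)
    then have "pT\<^sup>2 * (pN * dd) = pT\<^sup>2 * ANN * (p \<bullet> (H *v N)) - (pT * b) * (\<nu> \<bullet> (A *v \<nu>))"
      by (simp add: algebra_simps power2_eq_square)
    also have "\<dots> \<le> 0 - (\<delta>0 / 2 * pT\<^sup>2) * (a0 * (norm p)\<^sup>2)"
    proof (rule diff_mono)
      show "pT\<^sup>2 * ANN * (p \<bullet> (H *v N)) \<le> 0"
        using Y A(1)[of N] by (intro mult_nonneg_nonpos mult_nonneg_nonneg) (auto simp: ANN_def)
      show "(\<delta>0 / 2 * pT\<^sup>2) * (a0 * (norm p)\<^sup>2) \<le> (pT * b) * (\<nu> \<bullet> (A *v \<nu>))"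
      proof (rule mult_mono[OF beta low])
        have "0 \<le> \<delta>0 / 2 * pT\<^sup>2" using k(2) by simp
        then show "0 \<le> pT * b" using beta by (rule order_trans)
        show "0 \<le> a0 * (norm p)\<^sup>2" using A(2) by simp
      qed
    qed
    finally have "pT\<^sup>2 * (pN * dd) \<le> pT\<^sup>2 * (- (\<delta>0 / 2 * a0 * (norm p)\<^sup>2))" by (simp add: algebra_simps)
    then have up: "pN * dd \<le> - (\<delta>0 / 2 * a0 * (norm p)\<^sup>2)" by (rule mult_left_le_imp_le[OF _ pT0])
    have "\<bar>pN\<bar> \<le> norm p" using Cauchy_Schwarz_ineq2[of p N] N by (simp add: pN_pT_def)
    then have "\<bar>pN * dd\<bar> \<le> norm p * K"
      unfolding abs_mult using K by (intro mult_mono) (auto simp: dd_def defs)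
    with up have "\<delta>0 / 2 * a0 * (norm p)\<^sup>2 \<le> norm p * K" by linarith
    then have "norm p * (\<delta>0 * a0 * norm p) \<le> norm p * (2 * K)" by (simp add: power2_eq_square algebra_simps)
    moreover have "norm p > 0"
    proof -
      have "0 < (norm p)\<^sup>2" unfolding pnorm using pT0 zero_le_power2[of pN] by linarith
      then show ?thesis by simp
    qed
    ultimately have "\<delta>0 * a0 * norm p \<le> 2 * K" by (rule mult_left_le_imp_le)
    then have "norm p \<le> 2 * K / (\<delta>0 * a0)" using k(2) A(2) by (simp add: pos_le_divide_eq mult.commute)
    then show ?thesis using t2 by (simp add: defs)
  qed
qed

section \<open>The gradient estimate\<close>

text \<open>The equation is imposed inside the domain only; both sides are continuous up to the boundary, so it
  holds on the closure.\<close>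

lemma
  assumes dom: "bounded_domain_of_class 3 \<Omega>"
    and F: "positive_homogeneous_smooth F" "convex_on UNIV F" and G: "positive_homogeneous_smooth G"
    and sol: "smooth_solution \<Omega> F G \<theta> u\<^sub>0 T u"
  shows smooth_solution_regular: "regular_evolution \<Omega> T u (Dt T u)"
    and smooth_solution_equation: "x \<in> closure \<Omega> \<Longrightarrow> t \<in> {0..T} \<Longrightarrow>
      Dt T u x t = flow_operator (flow_matrix F G) \<Omega> u x t"
proof -
  let ?S = "closure \<Omega>"
  have s: "smooth_up_to_boundary \<Omega> T u" using sol by (simp add: smooth_solution_def)
  then have C: "C_on 2 ?S (\<lambda>x. u x t)" if "t \<in> {0..T}" for t
    using that by (simp add: smooth_up_to_boundary_def)
  show reg: "regular_evolution \<Omega> T u (Dt T u)"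
    unfolding regular_evolution_def
  proof (intro conjI ballI)
    show "continuous_on (?S \<times> {0..T}) (\<lambda>(x, t). u x t)" using s by (simp add: smooth_up_to_boundary_def)
    fix t assume t: "t \<in> {0..T}"
    then show "C_on 2 ?S (\<lambda>x. u x t)" by (rule C)
    fix x assume x: "x \<in> ?S"
    have "u x differentiable (at t within {0..T})"
      using s x t by (auto simp: smooth_up_to_boundary_def differentiable_on_def)
    from has_derivative_grad[OF this]
    show "(u x has_real_derivative Dt T u x t) (at t within {0..T})"
      by (simp add: has_field_derivative_def grad_def)
  qed
  assume x: "x \<in> ?S" and t: "t \<in> {0..T}"
  let ?d = "\<lambda>x. Dt T u x t - flow_operator (flow_matrix F G) \<Omega> u x t"
  have "continuous_on ?S (\<lambda>x. (\<lambda>(x, t). Dt T u x t) (x, t))"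
    by (rule continuous_on_compose2[of "?S \<times> {0..T}"])
       (use s t in \<open>auto simp: smooth_up_to_boundary_def intro!: continuous_intros\<close>)
  moreover have "continuous_on ?S (\<lambda>x. flow_operator (flow_matrix F G) \<Omega> u x t)"
    unfolding double_dot_def
    by (intro continuous_intros continuous_on_component C_on_2_cont_hess[OF C[OF t]]
        continuous_on_compose2[OF flow_matrix_cont[OF F G] C_on_2_cont_grad[OF C[OF t]]]) auto
  ultimately have "continuous_on ?S ?d" by (intro continuous_on_diff) auto
  moreover have "?d x = 0" if "x \<in> \<Omega>" for x
    using sol that t
    by (simp add: smooth_solution_def double_dot_def flow_matrix_def hess_def mult.assoc)
  ultimately have "?d x = 0" using continuous_constant_on_closure[of \<Omega> ?d] x by blast
  then show "Dt T u x t = flow_operator (flow_matrix F G) \<Omega> u x t" by simp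
qed

theorem theorem3p1:
  fixes \<Omega> :: "(real^2) set"
    and F G :: "real^3 \<Rightarrow> real"
    and \<theta> u\<^sub>0 :: "real^2 \<Rightarrow> real"
    and g0 G0 m0 M0 m1 m2 k0 k1 \<delta>0 \<theta>0 :: real
  assumes "positive_homogeneous_smooth F" and "convex_on UNIV F"
    and "positive_homogeneous_smooth G"
    and "structure_bounds F G g0 G0 m0 M0 m1 m2"
    and A1: "bounded_domain_of_class 3 \<Omega>" "0 < k0" "0 < k1"
      "\<forall>x\<in>frontier \<Omega>. k0 \<le> curvature \<Omega> x \<and> curvature \<Omega> x \<le> k1"
    and A2: "C_on_boundary 3 \<Omega> \<theta>" "0 < \<delta>0" "0 < \<theta>0"
      "\<forall>x\<in>frontier \<Omega>. \<bar>tangential_deriv \<Omega> \<theta> x\<bar> \<le> curvature \<Omega> x - \<delta>0"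
      "\<forall>x\<in>frontier \<Omega>. \<theta>0 \<le> \<theta> x \<and> \<theta> x \<le> pi - \<theta>0"
    and A3: "m2 < m0"
    and A4: "C_on 3 (closure \<Omega>) u\<^sub>0" "contact_angle_condition \<Omega> \<theta> u\<^sub>0"
  shows "\<exists>C1>0. \<forall>T>0. \<forall>u. smooth_solution \<Omega> F G \<theta> u\<^sub>0 T u \<longrightarrow>
           (\<forall>x\<in>\<Omega>. \<forall>t\<in>{0..T}. norm (grad (closure \<Omega>) (\<lambda>y. u y t) x) \<le> C1)"
proof -
  let ?S = "closure \<Omega>" and ?A = "flow_matrix F G"
  have op: "open \<Omega>" and ne: "\<Omega> \<noteq> {}" and cpt: "compact ?S"
    using A1(1) by (auto simp: bounded_domain_of_class_def)
  have psd: "0 \<le> \<nu> \<bullet> (?A q *v \<nu>)" for q \<nu> using flow_matrix_psd[OF assms(1-3)] .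
  have g0: "0 < g0" using assms(4) by (simp add: structure_bounds_def)
  define a0 where "a0 = g0 * (m0 - m2)"
  have a0: "0 < a0" using g0 A3 by (simp add: a0_def)
  have C2: "C_on 2 ?S u\<^sub>0"
    using C_on_Suc_imp[of 2 ?S u\<^sub>0] A4(1) by (simp add: numeral_3_eq_3 numeral_2_eq_2)
  have cg: "continuous_on ?S (grad ?S u\<^sub>0)" by (rule C_on_2_cont_grad[OF C2])
  have "continuous_on ?S (\<lambda>x. double_dot (?A (grad ?S u\<^sub>0 x)) (hess ?S u\<^sub>0 x))"
    unfolding double_dot_def
    by (intro continuous_intros continuous_on_component C_on_2_cont_hess[OF C2]
        continuous_on_compose2[OF flow_matrix_cont[OF assms(1-3)] cg]) auto
  then have "bounded ((\<lambda>x. double_dot (?A (grad ?S u\<^sub>0 x)) (hess ?S u\<^sub>0 x)) ` ?S)"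
    by (intro compact_imp_bounded compact_continuous_image cpt)
  then obtain K where K: "\<And>x. x \<in> ?S \<Longrightarrow> \<bar>double_dot (?A (grad ?S u\<^sub>0 x)) (hess ?S u\<^sub>0 x)\<bar> \<le> K"
    unfolding bounded_iff by auto
  have "bounded (grad ?S u\<^sub>0 ` ?S)"
    by (intro compact_imp_bounded compact_continuous_image cpt cg)
  then obtain B where B: "\<And>x. x \<in> ?S \<Longrightarrow> norm (grad ?S u\<^sub>0 x) \<le> B"
    unfolding bounded_iff by auto
  have sin\<theta>: "sin \<theta>0 \<le> sin (\<theta> x) \<and> 0 < sin \<theta>0 \<and> \<bar>cos (\<theta> x)\<bar> < 1" if x: "x \<in> frontier \<Omega>" for x
  proof -
    have r: "\<theta>0 \<le> \<theta> x" "\<theta> x \<le> pi - \<theta>0" using A2(5) x by auto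
    have s0: "0 < sin \<theta>0" using A2(3) r by (intro sin_gt_zero) auto
    have "sin \<theta>0 \<le> sin (\<theta> x)"
    proof (cases "\<theta> x \<le> pi / 2")
      case True
      then show ?thesis using r A2(3) by (intro sin_monotone_2pi_le) auto
    next
      case False
      have "sin \<theta>0 \<le> sin (pi - \<theta> x)" using False r A2(3) by (intro sin_monotone_2pi_le) auto
      then show ?thesis by simp
    qed
    moreover have "0 < (sin (\<theta> x))\<^sup>2" using s0 calculation by simp
    then have "(cos (\<theta> x))\<^sup>2 < 1" using sin_cos_squared_add[of "\<theta> x"] by linarith
    then have "\<bar>cos (\<theta> x)\<bar> < 1" by (simp add: abs_square_less_1)
    ultimately show ?thesis using s0 by simp
  qed
  define C1 where "C1 = max (max B (2 * K / (\<delta>0 * a0) + sqrt (1 + k1 / \<delta>0) / sin \<theta>0)) 1"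
  have "norm (Dx \<Omega> u x t) \<le> C1"
    if T: "0 < T" and sol: "smooth_solution \<Omega> F G \<theta> u\<^sub>0 T u" and x: "x \<in> \<Omega>" and t: "t \<in> {0..T}" for T u x t
  proof -
    note reg = smooth_solution_regular[OF A1(1) assms(1-3) sol]
    note eqn = smooth_solution_equation[OF A1(1) assms(1-3) sol]
    have C: "C_on 2 ?S (\<lambda>x. u x t)" if "t \<in> {0..T}" for t using reg that by (simp add: regular_evolution_def)
    have bc: "contact_angle_condition \<Omega> \<theta> (\<lambda>x. u x t)" if "t \<in> {0..T}" for t
      using sol that by (simp add: smooth_solution_def)
    have init: "u y 0 = u\<^sub>0 y" if "y \<in> ?S" for y
    proof -
      have "continuous_on ?S (\<lambda>x. u x 0 - u\<^sub>0 x)"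
        using C_on_2_cont[OF C, of 0] C_on_2_cont[OF C2] T by (intro continuous_on_diff) auto
      moreover have "u x 0 - u\<^sub>0 x = 0" if "x \<in> \<Omega>" for x using sol that by (simp add: smooth_solution_def)
      ultimately show ?thesis
        using continuous_constant_on_closure[of \<Omega> "\<lambda>x. u x 0 - u\<^sub>0 x" 0 y] that by simp
    qed
    have g0: "Dx \<Omega> u y 0 = grad ?S u\<^sub>0 y" and h0: "hess ?S (\<lambda>x. u x 0) y = hess ?S u\<^sub>0 y" if "y \<in> ?S" for y
      using grad_cong[OF that init] hess_cong[OF that init] by auto
    have ut: "\<bar>Dt T u y s\<bar> \<le> K" if "y \<in> ?S" "s \<in> {0..T}" for y s
    proof (rule time_derivative_bound[where \<theta> = \<theta> and A = ?A, OF A1(1) _ psd T reg bc eqn _ that])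
      show "\<bar>cos (\<theta> x)\<bar> < 1" if "x \<in> frontier \<Omega>" for x using sin\<theta>[OF that] by simp
      show "\<bar>flow_operator ?A \<Omega> u x 0\<bar> \<le> K" if "x \<in> ?S" for x using K[OF that] g0[OF that] h0[OF that] by simp
    qed
    have cont: "continuous_on (?S \<times> {0..T}) (\<lambda>(x, t). Dx \<Omega> u x t)"
      using sol by (simp add: smooth_solution_def smooth_up_to_boundary_def)
    \<comment> \<open>The maximum over the parabolic boundary is the maximum over the whole cylinder.\<close>
    define P where "P = frontier \<Omega> \<times> {0..T} \<union> ?S \<times> {0}"
    have PS: "P \<subseteq> ?S \<times> {0..T}" using T by (auto simp: P_def frontier_def)
    have "compact P"
      unfolding P_def by (intro compact_Un compact_Times cpt compact_frontier_bounded)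
        (use A1(1) in \<open>auto simp: bounded_domain_of_class_def\<close>)
    moreover have "P \<noteq> {}" using ne by (auto simp: P_def)
    moreover have cP: "continuous_on P (\<lambda>z. norm ((\<lambda>(x, t). Dx \<Omega> u x t) z))"
      by (intro continuous_on_norm continuous_on_subset[OF cont PS])
    ultimately obtain z where z: "z \<in> P" "\<And>z'. z' \<in> P \<Longrightarrow>
        norm ((\<lambda>(x, t). Dx \<Omega> u x t) z') \<le> norm ((\<lambda>(x, t). Dx \<Omega> u x t) z)"
      using continuous_attains_sup[OF _ _ cP] by blast
    obtain y s where ys: "z = (y, s)" "y \<in> ?S" "s \<in> {0..T}" using z(1) PS by (cases z) auto
    have all: "norm (Dx \<Omega> u x t) \<le> norm (Dx \<Omega> u y s)" if "x \<in> ?S" "t \<in> {0..T}" for x t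
    proof (rule gradient_max_principle[where A = ?A, OF A1(1) psd reg eqn cont _ _ that])
      show "norm (Dx \<Omega> u x t) \<le> norm (Dx \<Omega> u y s)" if "x \<in> frontier \<Omega>" "t \<in> {0..T}" for x t
        using z(2)[of "(x, t)"] that ys(1) by (simp add: P_def)
      show "norm (Dx \<Omega> u x 0) \<le> norm (Dx \<Omega> u y s)" if "x \<in> ?S" for x
        using z(2)[of "(x, 0)"] that ys(1) by (simp add: P_def)
    qed
    have "norm (Dx \<Omega> u y s) \<le> C1"
    proof (cases "s = 0")
      case True
      then show ?thesis using B[OF ys(2)] g0[OF ys(2)] by (simp add: C1_def)
    next
      case False
      then have yf: "y \<in> frontier \<Omega>" using z(1) ys(1) by (simp add: P_def)
      have "norm (Dx \<Omega> u y s) \<le> 2 * K / (\<delta>0 * a0) + sqrt (1 + k1 / \<delta>0) / sin \<theta>0"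
      proof (rule boundary_gradient_bound[where A = "?A (Dx \<Omega> u y s)", OF A1(1) yf C[OF ys(3)] bc[OF ys(3)]])
        show "a0 * (norm \<nu>)\<^sup>2 \<le> \<nu> \<bullet> (?A (Dx \<Omega> u y s) *v \<nu>)" if "Dx \<Omega> u y s \<bullet> \<nu> = 0" for \<nu>
          unfolding a0_def by (rule flow_matrix_orthogonal[OF assms(1-4) A3 that])
        show "\<bar>flow_operator ?A \<Omega> u y s\<bar> \<le> K" using ut[OF ys(2,3)] eqn[OF ys(2,3)] by simp
      qed (use all[OF _ ys(3)] A2 A1(4) yf sin\<theta>[OF yf] psd a0 in auto)
      then show ?thesis by (simp add: C1_def)
    qed
    then show ?thesis using all[of x t] x t closure_subset by force
  qed
  moreover have "0 < C1" by (simp add: C1_def)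
  ultimately show ?thesis by blast
qed

end
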